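(* Let $C$ be a monotone $\Pi_t$ circuit, and let $G = (V,E)$ be the underlying undirected graph of $C$ with the output gate removed. If a tree decomposition of width $\omega$ for $G$ is given, then a minimum-weight satisfying assignment of $C$ can be computed in time $2^{O(\omega)}N^{O(1)}$, where $N$ is the number of nodes in the given tree decomposition.
   Context: A $\Pi_t$ circuit ($t\ge2$) is a Boolean circuit in normalized form of depth at most $t$: the output gate is an AND-gate, every non-variable gate has outdegree at most 1, and starting from the output gate the gates alternate between AND-gates and OR-gates (no NOT-gates; input vertices are literals). Monotone means all input literals are positive. The weight of an assignment is the number of variables set to 1. A tree decomposition and its width are the standard notions. *)

theory Defs
  imports Complex_Main "HOL-Library.Landau_Symbols"
begin

section \<open>Boolean circuits\<close>

datatype label = And | Or | Lit nat bool  \<comment> \<open>\<open>Lit x True\<close> is \<open>x\<close>, \<open>Lit x False\<close> is its negation\<close>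

record circuit =
  verts :: "nat set"
  lab   :: "nat \<Rightarrow> label"
  wires :: "(nat \<times> nat) set"  \<comment> \<open>\<open>(u, v)\<close>: the value of \<open>u\<close> is an input of the gate \<open>v\<close>\<close>
  out   :: nat

definition is_lit :: "label \<Rightarrow> bool" where
  "is_lit l \<longleftrightarrow> (\<exists>x b. l = Lit x b)"

definition input_verts :: "circuit \<Rightarrow> nat set" where
  "input_verts C = {v \<in> verts C. is_lit (lab C v)}"

definition gate_verts :: "circuit \<Rightarrow> nat set" where
  "gate_verts C = {v \<in> verts C. \<not> is_lit (lab C v)}"

text \<open>Each literal is the label of at most one input vertex, so all gates that read a variable
  are joined to the same vertex. The output is a designated gate of outdegree 0; further
  vertices of outdegree 0 are allowed.\<close>

definition circuit :: "circuit \<Rightarrow> bool" where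
  "circuit C \<longleftrightarrow>
     finite (verts C) \<and> wires C \<subseteq> verts C \<times> verts C \<and> acyclic (wires C) \<and>
     (\<forall>v\<in>verts C. is_lit (lab C v) \<longleftrightarrow> (\<forall>u. (u, v) \<notin> wires C)) \<and>
     inj_on (lab C) (input_verts C) \<and>
     out C \<in> gate_verts C \<and> (\<forall>v. (out C, v) \<notin> wires C)"

text \<open>A path from an input vertex to the output of length \<open>k\<close> has \<open>k\<close> wires, so that a CNF has
  depth 2.\<close>

definition depth_le :: "circuit \<Rightarrow> nat \<Rightarrow> bool" where
  "depth_le C t \<longleftrightarrow> (\<forall>v\<in>input_verts C. \<forall>k. (v, out C) \<in> wires C ^^ k \<longrightarrow> k \<le> t)"

definition pi_circuit :: "nat \<Rightarrow> circuit \<Rightarrow> bool" where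
  "pi_circuit t C \<longleftrightarrow>
     circuit C \<and> depth_le C t \<and> lab C (out C) = And \<and>
     (\<forall>v\<in>gate_verts C. card {w. (v, w) \<in> wires C} \<le> 1) \<and>
     (\<forall>u\<in>gate_verts C. \<forall>v\<in>gate_verts C.
        (u, v) \<in> wires C \<and> (v, out C) \<in> (wires C)\<^sup>* \<longrightarrow> lab C u \<noteq> lab C v)"

definition monotone_circuit :: "circuit \<Rightarrow> bool" where
  "monotone_circuit C \<longleftrightarrow> (\<forall>v\<in>input_verts C. \<exists>x. lab C v = Lit x True)"

definition vars :: "circuit \<Rightarrow> nat set" where
  "vars C = {x. \<exists>v\<in>verts C. \<exists>b. lab C v = Lit x b}"

text \<open>As the wires are acyclic and finite, the least fixed point is the only valuation of the
  vertices that is compatible with the labels.\<close>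

inductive true_at :: "circuit \<Rightarrow> (nat \<Rightarrow> bool) \<Rightarrow> nat \<Rightarrow> bool" for C \<sigma> where
  lit: "lab C v = Lit x b \<Longrightarrow> \<sigma> x = b \<Longrightarrow> true_at C \<sigma> v"
| conj: "lab C v = And \<Longrightarrow> (\<And>u. (u, v) \<in> wires C \<Longrightarrow> true_at C \<sigma> u) \<Longrightarrow> true_at C \<sigma> v"
| disj: "lab C v = Or \<Longrightarrow> (u, v) \<in> wires C \<Longrightarrow> true_at C \<sigma> u \<Longrightarrow> true_at C \<sigma> v"

definition satisfies :: "(nat \<Rightarrow> bool) \<Rightarrow> circuit \<Rightarrow> bool" where
  "satisfies \<sigma> C \<longleftrightarrow> true_at C \<sigma> (out C)"

definition weight :: "circuit \<Rightarrow> (nat \<Rightarrow> bool) \<Rightarrow> nat" where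
  "weight C \<sigma> = card {x \<in> vars C. \<sigma> x}"

definition min_weight_satisfying :: "circuit \<Rightarrow> (nat \<Rightarrow> bool) \<Rightarrow> bool" where
  "min_weight_satisfying C \<sigma> \<longleftrightarrow>
     satisfies \<sigma> C \<and> (\<forall>\<tau>. satisfies \<tau> C \<longrightarrow> weight C \<sigma> \<le> weight C \<tau>)"


section \<open>Graphs and tree decompositions\<close>

type_synonym ugraph = "nat set \<times> nat set set"

definition graph_without_output :: "circuit \<Rightarrow> ugraph" where
  "graph_without_output C =
     (verts C - {out C}, {{u, v} | u v. (u, v) \<in> wires C \<and> u \<noteq> out C \<and> v \<noteq> out C})"

definition simple_graph :: "ugraph \<Rightarrow> bool" where
  "simple_graph G \<longleftrightarrow>
     finite (fst G) \<and> snd G \<subseteq> {{u, v} | u v. u \<in> fst G \<and> v \<in> fst G \<and> u \<noteq> v}"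

text \<open>\<open>connected_in F S\<close>: the subgraph induced by \<open>S\<close> is connected.\<close>

definition connected_in :: "nat set set \<Rightarrow> nat set \<Rightarrow> bool" where
  "connected_in F S \<longleftrightarrow>
     (\<forall>i\<in>S. \<forall>j\<in>S. (i, j) \<in> {(a, b). a \<in> S \<and> b \<in> S \<and> {a, b} \<in> F}\<^sup>*)"

definition cycle :: "nat set set \<Rightarrow> nat list \<Rightarrow> bool" where
  "cycle F p \<longleftrightarrow>
     3 \<le> length p \<and> distinct p \<and>
     (\<forall>i<length p. {p ! i, p ! (Suc i mod length p)} \<in> F)"

definition tree :: "ugraph \<Rightarrow> bool" where
  "tree G \<longleftrightarrow>
     simple_graph G \<and> fst G \<noteq> {} \<and> connected_in (snd G) (fst G) \<and> (\<nexists>p. cycle (snd G) p)"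

record tree_dec =
  nodes  :: "nat set"
  tedges :: "nat set set"
  bag    :: "nat \<Rightarrow> nat set"

definition tree_decomposition :: "ugraph \<Rightarrow> tree_dec \<Rightarrow> bool" where
  "tree_decomposition G T \<longleftrightarrow>
     tree (nodes T, tedges T) \<and>
     (\<Union>i\<in>nodes T. bag T i) = fst G \<and>
     (\<forall>e\<in>snd G. \<exists>i\<in>nodes T. e \<subseteq> bag T i) \<and>
     (\<forall>v\<in>fst G. connected_in (tedges T) {i \<in> nodes T. v \<in> bag T i})"

text \<open>The graph of a circuit without the output is nonempty (the output has an input), hence the
  subtraction is not truncated there.\<close>

definition width :: "tree_dec \<Rightarrow> nat" where
  "width T = Max ((\<lambda>i. card (bag T i)) ` nodes T) - 1"


section \<open>Machine model\<close>

text \<open>Running time is measured in pure first-order LISP. Data are S-expressions over opaque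
  symbols, which can only be copied and tested for equality. A program is a list of function
  bodies, called by index, with recursion and call by value. Evaluating each
  subexpression costs one step, and each step is one elementary operation on atoms or on a
  single cons cell (values are shared, never copied). There is no arithmetic, so time is
  polynomially related to time on Turing machines.\<close>

datatype sexp = SNil | Sym nat | SCons sexp sexp

fun car :: "sexp \<Rightarrow> sexp" where
  "car (SCons a b) = a"
| "car _ = SNil"

fun cdr :: "sexp \<Rightarrow> sexp" where
  "cdr (SCons a b) = b"
| "cdr _ = SNil"

text \<open>\<open>SNil\<close> is false, everything else is true. Conses are never equal in the sense of
  \<open>eq_atom\<close>.\<close>

abbreviation truth :: "bool \<Rightarrow> sexp" where
  "truth b \<equiv> (if b then Sym 0 else SNil)"

fun eq_atom :: "sexp \<Rightarrow> sexp \<Rightarrow> bool" where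
  "eq_atom SNil SNil \<longleftrightarrow> True"
| "eq_atom (Sym i) (Sym j) \<longleftrightarrow> i = j"
| "eq_atom _ _ \<longleftrightarrow> False"

fun is_cons :: "sexp \<Rightarrow> bool" where
  "is_cons (SCons a b) \<longleftrightarrow> True"
| "is_cons _ \<longleftrightarrow> False"

datatype expr =
    Arg nat
  | Quote sexp
  | MkCons expr expr
  | Car expr
  | Cdr expr
  | EqAtom expr expr
  | IsCons expr
  | Cond expr expr expr
  | Call nat "expr list"

type_synonym program = "expr list"

text \<open>\<open>eval P env e v n\<close>: with arguments \<open>env\<close>, the expression \<open>e\<close> evaluates to \<open>v\<close> in \<open>n\<close>
  steps; \<open>evals\<close> does the same for a list of expressions, with the total number of steps.\<close>

inductive eval :: "program \<Rightarrow> sexp list \<Rightarrow> expr \<Rightarrow> sexp \<Rightarrow> nat \<Rightarrow> bool"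
  and evals :: "program \<Rightarrow> sexp list \<Rightarrow> expr list \<Rightarrow> sexp list \<Rightarrow> nat \<Rightarrow> bool"
  for P where
  Arg: "i < length env \<Longrightarrow> eval P env (Arg i) (env ! i) 1"
| Quote: "eval P env (Quote s) s 1"
| MkCons: "eval P env a v m \<Longrightarrow> eval P env b w n \<Longrightarrow>
    eval P env (MkCons a b) (SCons v w) (m + n + 1)"
| Car: "eval P env a v m \<Longrightarrow> eval P env (Car a) (car v) (m + 1)"
| Cdr: "eval P env a v m \<Longrightarrow> eval P env (Cdr a) (cdr v) (m + 1)"
| EqAtom: "eval P env a v m \<Longrightarrow> eval P env b w n \<Longrightarrow>
    eval P env (EqAtom a b) (truth (eq_atom v w)) (m + n + 1)"
| IsCons: "eval P env a v m \<Longrightarrow> eval P env (IsCons a) (truth (is_cons v)) (m + 1)"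
| CondTrue: "eval P env c u k \<Longrightarrow> u \<noteq> SNil \<Longrightarrow> eval P env a v m \<Longrightarrow>
    eval P env (Cond c a b) v (k + m + 1)"
| CondFalse: "eval P env c SNil k \<Longrightarrow> eval P env b v m \<Longrightarrow>
    eval P env (Cond c a b) v (k + m + 1)"
| Call: "f < length P \<Longrightarrow> evals P env as vs m \<Longrightarrow> eval P vs (P ! f) v n \<Longrightarrow>
    eval P env (Call f as) v (m + n + 1)"
| Empty: "evals P env [] [] 0"
| Next: "eval P env a v m \<Longrightarrow> evals P env as vs n \<Longrightarrow> evals P env (a # as) (v # vs) (m + n)"

inductive_cases eval_elims:
  "eval P env (Arg i) v n"
  "eval P env (Quote s) v n"
  "eval P env (MkCons a b) v n"
  "eval P env (Car a) v n"
  "eval P env (Cdr a) v n"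
  "eval P env (EqAtom a b) v n"
  "eval P env (IsCons a) v n"
  "eval P env (Cond c a b) v n"
  "eval P env (Call f as) v n"
  "evals P env [] vs n"
  "evals P env (a # as) vs n"

lemma eval_deterministic:
  "eval P env e v n \<Longrightarrow> eval P env e v' n' \<Longrightarrow> v = v' \<and> n = n'"
  "evals P env es vs n \<Longrightarrow> evals P env es vs' n' \<Longrightarrow> vs = vs' \<and> n = n'"
proof (induction arbitrary: v' n' and vs' n' rule: eval_evals.inducts)
  case Arg
  from Arg.prems show ?case
    by (rule eval_elims(1)) simp
next
  case Quote
  from Quote.prems show ?case
    by (rule eval_elims(2)) simp
next
  case MkCons
  from MkCons.prems show ?case
    by (rule eval_elims(3)) (auto dest: MkCons.IH(2,4))
next
  case Car
  from Car.prems show ?case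
    by (rule eval_elims(4)) (auto dest: Car.IH(2))
next
  case Cdr
  from Cdr.prems show ?case
    by (rule eval_elims(5)) (auto dest: Cdr.IH(2))
next
  case EqAtom
  from EqAtom.prems show ?case
    by (rule eval_elims(6)) (auto dest: EqAtom.IH(2,4))
next
  case IsCons
  from IsCons.prems show ?case
    by (rule eval_elims(7)) (auto dest: IsCons.IH(2))
next
  case CondTrue
  from CondTrue.prems show ?case
    by (rule eval_elims(8)) (use CondTrue.hyps in \<open>auto dest: CondTrue.IH(2,4)\<close>)
next
  case CondFalse
  from CondFalse.prems show ?case
    by (rule eval_elims(8)) (auto dest: CondFalse.IH(2,4))
next
  case Call
  from Call.prems show ?case
    by (rule eval_elims(9)) (auto dest: Call.IH(3,5))
next
  case Empty
  from Empty.prems show ?case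
    by (rule eval_elims(10)) simp
next
  case Next
  from Next.prems show ?case
    by (rule eval_elims(11)) (auto dest: Next.IH(2,4))
qed

definition computes :: "program \<Rightarrow> sexp list \<Rightarrow> sexp \<Rightarrow> nat \<Rightarrow> bool" where
  "computes P xs y n \<longleftrightarrow> P \<noteq> [] \<and> eval P xs (P ! 0) y n"


section \<open>Input and output format\<close>

definition enc_list :: "('a \<Rightarrow> sexp) \<Rightarrow> 'a list \<Rightarrow> sexp" where
  "enc_list f xs = foldr (\<lambda>x s. SCons (f x) s) xs SNil"

definition enc_pair :: "nat \<times> nat \<Rightarrow> sexp" where
  "enc_pair p = SCons (Sym (fst p)) (Sym (snd p))"

fun enc_label :: "label \<Rightarrow> sexp" where
  "enc_label And = Sym 0"
| "enc_label Or = Sym 1"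
| "enc_label (Lit x b) = SCons (truth b) (Sym x)"

text \<open>Sets are presented as lists without repetitions, in any order.\<close>

definition encodes_circuit :: "sexp \<Rightarrow> circuit \<Rightarrow> bool" where
  "encodes_circuit s C \<longleftrightarrow>
     (\<exists>vs ws. distinct vs \<and> set vs = verts C \<and> distinct ws \<and> set ws = wires C \<and>
        s = SCons (Sym (out C))
              (SCons (enc_list (\<lambda>v. SCons (Sym v) (enc_label (lab C v))) vs)
                    (enc_list enc_pair ws)))"

text \<open>A tree edge is listed once, with its endpoints in either order.\<close>

definition encodes_tree_dec :: "sexp \<Rightarrow> tree_dec \<Rightarrow> bool" where
  "encodes_tree_dec s T \<longleftrightarrow>
     (\<exists>ns es bs. distinct ns \<and> set ns = nodes T \<and>
        distinct (map (\<lambda>(i, j). {i, j}) es) \<and> (\<lambda>(i, j). {i, j}) ` set es = tedges T \<and>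
        (\<forall>i\<in>nodes T. distinct (bs i) \<and> set (bs i) = bag T i) \<and>
        s = SCons (enc_list (\<lambda>i. SCons (Sym i) (enc_list Sym (bs i))) ns)
                 (enc_list enc_pair es))"

text \<open>An assignment is output as the list of the variables that are set to 1.\<close>

definition encodes_assignment :: "circuit \<Rightarrow> sexp \<Rightarrow> (nat \<Rightarrow> bool) \<Rightarrow> bool" where
  "encodes_assignment C s \<sigma> \<longleftrightarrow>
     (\<exists>xs. distinct xs \<and> set xs = {x \<in> vars C. \<sigma> x} \<and> s = enc_list Sym xs)"

end

theory Submission imports Defs begin

text \<open>
  A satisfying assignment amounts to a set of vertices that contains the output, with an AND-gate
  all of its inputs, and with an OR-gate one of its inputs; acyclicity makes every vertex of such a
  set true. Lightest sets of this kind are found by dynamic programming along the decomposition.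
  A partial solution records the chosen and the rejected vertices of the bags seen so far, and only
  the lightest partial solution is kept for each behaviour on the current bag: which vertices are
  chosen, which are rejected, and which gates already have a chosen input. There are at most
  \<open>8 ^ (\<omega> + 1)\<close> behaviours. The output vertex may be left out of the bags because it is chosen in
  every solution.

  The tree is not rooted beforehand: the table of the component of a node \<open>i\<close> is obtained by
  deleting any edge \<open>{i, k}\<close> and merging the tables of the components of \<open>i\<close> and \<open>k\<close>. Every edge of
  a tree is a bridge, so these components are disjoint, share vertices only through the bags of
  \<open>i\<close> and \<open>k\<close>, and there are fewer than \<open>2 N\<close> recursive calls.
\<close>

section \<open>Symbolic evaluation with step counts\<close>

text \<open>A demand can outlast a part of the tree only through the bag: a chosen AND-gate and a
  rejected input occur together in some bag, and an OR-gate may wait for a chosen input only while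
  it stays in the bag. The wires into the output lie in no bag, but a gate that is always chosen
  needs no memory: each part checks its own inputs of the output. Replacing a partial solution by a
  lighter one with the same signature is safe because two parts overlap, apart from the output, only
  in bag vertices, whose choice the signature fixes; so the literals counted twice are the same
  before and after. Monotonicity turns weight into a number of chosen vertices: distinct input
  vertices carry distinct variables, and chosen literals never conflict. As the machine has no
  numbers, an entry carries its whole lists of vertices, and weights are compared as lengths of
  lists. Three bits per bag vertex give the base 8, and the product of two tables squares the table
  size before it is reduced again. This fixes the exponent of the final bound.\<close>

definition wp :: "program \<Rightarrow> sexp list \<Rightarrow> expr \<Rightarrow> (sexp \<Rightarrow> nat \<Rightarrow> bool) \<Rightarrow> bool" where
  "wp P env e Q \<longleftrightarrow> (\<exists>v n. eval P env e v n \<and> Q v n)"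

definition wps :: "program \<Rightarrow> sexp list \<Rightarrow> expr list \<Rightarrow> (sexp list \<Rightarrow> nat \<Rightarrow> bool) \<Rightarrow> bool" where
  "wps P env es Q \<longleftrightarrow> (\<exists>vs n. evals P env es vs n \<and> Q vs n)"

text \<open>Has no simp rule, so that symbolic evaluation halts at each call, where
  \<open>runs_call\<close> supplies the specification of the callee.\<close>

definition wp_call :: "program \<Rightarrow> nat \<Rightarrow> sexp list \<Rightarrow> (sexp \<Rightarrow> nat \<Rightarrow> bool) \<Rightarrow> bool" where
  "wp_call P f vs Q \<longleftrightarrow> f < length P \<and> wp P vs (P ! f) Q"

text \<open>Each equation combines one evaluation rule with its inversion. With all of them, simp
  executes a function body symbolically and adds up the steps.\<close>

lemma wp_simps [simp]:
  "wp P env (Arg i) Q \<longleftrightarrow> i < length env \<and> Q (env ! i) 1"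
  "wp P env (Quote s) Q \<longleftrightarrow> Q s 1"
  "wp P env (MkCons a b) Q \<longleftrightarrow> wp P env a (\<lambda>v m. wp P env b (\<lambda>w n. Q (SCons v w) (m + n + 1)))"
  "wp P env (Car a) Q \<longleftrightarrow> wp P env a (\<lambda>v m. Q (car v) (m + 1))"
  "wp P env (Cdr a) Q \<longleftrightarrow> wp P env a (\<lambda>v m. Q (cdr v) (m + 1))"
  "wp P env (EqAtom a b) Q \<longleftrightarrow>
     wp P env a (\<lambda>v m. wp P env b (\<lambda>w n. Q (truth (eq_atom v w)) (m + n + 1)))"
  "wp P env (IsCons a) Q \<longleftrightarrow> wp P env a (\<lambda>v m. Q (truth (is_cons v)) (m + 1))"
  "wp P env (Cond c a b) Q \<longleftrightarrow>
     wp P env c (\<lambda>u k. if u = SNil then wp P env b (\<lambda>v m. Q v (k + m + 1))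
                       else wp P env a (\<lambda>v m. Q v (k + m + 1)))"
  "wp P env (Call f as) Q \<longleftrightarrow>
     wps P env as (\<lambda>vs m. wp_call P f vs (\<lambda>v n. Q v (m + n + 1)))"
  "wps P env [] R \<longleftrightarrow> R [] 0"
  "wps P env (a # as) R \<longleftrightarrow> wp P env a (\<lambda>v m. wps P env as (\<lambda>vs n. R (v # vs) (m + n)))"
proof -
  note [simp] = wp_def wps_def wp_call_def
  show "wp P env (Arg i) Q \<longleftrightarrow> i < length env \<and> Q (env ! i) 1"
    by (auto elim!: eval_elims(1) intro: eval_evals.Arg[simplified])
  show "wp P env (Quote s) Q \<longleftrightarrow> Q s 1"
    by (auto elim!: eval_elims(2) intro: eval_evals.Quote[simplified])
  show "wp P env (MkCons a b) Q \<longleftrightarrow> wp P env a (\<lambda>v m. wp P env b (\<lambda>w n. Q (SCons v w) (m + n + 1)))"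
    by (auto elim!: eval_elims(3)) (blast intro: eval_evals.MkCons[simplified])+
  show "wp P env (Car a) Q \<longleftrightarrow> wp P env a (\<lambda>v m. Q (car v) (m + 1))"
    by (auto elim!: eval_elims(4)) (blast intro: eval_evals.Car[simplified])+
  show "wp P env (Cdr a) Q \<longleftrightarrow> wp P env a (\<lambda>v m. Q (cdr v) (m + 1))"
    by (auto elim!: eval_elims(5)) (blast intro: eval_evals.Cdr[simplified])+
  show "wp P env (EqAtom a b) Q \<longleftrightarrow>
     wp P env a (\<lambda>v m. wp P env b (\<lambda>w n. Q (truth (eq_atom v w)) (m + n + 1)))"
    unfolding wp_def Suc_eq_plus1[symmetric]
    by (blast elim!: eval_elims(6) intro: eval_evals.EqAtom[unfolded Suc_eq_plus1[symmetric]])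
  show "wp P env (IsCons a) Q \<longleftrightarrow> wp P env a (\<lambda>v m. Q (truth (is_cons v)) (m + 1))"
    unfolding wp_def Suc_eq_plus1[symmetric]
    by (blast elim!: eval_elims(7) intro: eval_evals.IsCons[unfolded Suc_eq_plus1[symmetric]])
  show "wp P env (Cond c a b) Q \<longleftrightarrow>
     wp P env c (\<lambda>u k. if u = SNil then wp P env b (\<lambda>v m. Q v (k + m + 1))
                       else wp P env a (\<lambda>v m. Q v (k + m + 1)))"
    by (auto elim!: eval_elims(8) split: if_splits)
      (metis eval_evals.CondTrue eval_evals.CondFalse Suc_eq_plus1)+
  show "wp P env (Call f as) Q \<longleftrightarrow>
     wps P env as (\<lambda>vs m. wp_call P f vs (\<lambda>v n. Q v (m + n + 1)))"
    by (auto elim!: eval_elims(9)) (blast intro: eval_evals.Call[simplified])+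
  show "wps P env [] R \<longleftrightarrow> R [] 0"
    by (auto elim!: eval_elims(10) intro: eval_evals.Empty)
  show "wps P env (a # as) R \<longleftrightarrow> wp P env a (\<lambda>v m. wps P env as (\<lambda>vs n. R (v # vs) (m + n)))"
    by (auto elim!: eval_elims(11)) (blast intro: eval_evals.Next)+
qed

section \<open>The program\<close>

abbreviation true_expr :: expr where "true_expr \<equiv> Quote (Sym 0)"
abbreviation nil_expr :: expr where "nil_expr \<equiv> Quote SNil"

text \<open>The indices are the positions in \<open>prog\<close>.\<close>

abbreviation "mem_call \<equiv> \<lambda>a xs. Call 1 [a, xs]"
abbreviation "fed_call \<equiv> \<lambda>v S ws. Call 2 [v, S, ws]"
abbreviation "valid_call \<equiv> \<lambda>vl ws B e. Call 3 [vl, ws, B, e]"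
abbreviation "lits_call \<equiv> \<lambda>vl S. Call 4 [vl, S]"
abbreviation "le_call \<equiv> \<lambda>xs ys. Call 5 [xs, ys]"
abbreviation "sig_eq_call \<equiv> \<lambda>ws B e e'. Call 6 [ws, B, e, e']"
abbreviation "ins_call \<equiv> \<lambda>vl ws B e R. Call 7 [vl, ws, B, e, R]"
abbreviation "reduce_call \<equiv> \<lambda>vl ws B L. Call 8 [vl, ws, B, L]"
abbreviation "append_call \<equiv> \<lambda>xs ys. Call 9 [xs, ys]"
abbreviation "joins_call \<equiv> \<lambda>e L. Call 10 [e, L]"
abbreviation "product_call \<equiv> \<lambda>L L'. Call 11 [L, L']"
abbreviation "cands_call \<equiv> \<lambda>r vs. Call 12 [r, vs]"
abbreviation "pick_call \<equiv> \<lambda>E i. Call 13 [E, i]"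
abbreviation "del_call \<equiv> \<lambda>E i. Call 14 [E, i]"
abbreviation "bag_call \<equiv> \<lambda>ns i. Call 15 [ns, i]"
abbreviation "tab_call \<equiv> \<lambda>x ns E i. Call 16 [x, ns, E, i]"

definition mem_body :: expr where
  "mem_body = (let a = Arg 0; xs = Arg 1 in
     Cond (IsCons xs) (Cond (EqAtom a (Car xs)) true_expr (mem_call a (Cdr xs))) nil_expr)"

definition fed_body :: expr where
  "fed_body = (let v = Arg 0; S = Arg 1; ws = Arg 2 in
     Cond (IsCons ws)
       (Cond (Cond (EqAtom v (Cdr (Car ws))) (mem_call (Car (Car ws)) S) nil_expr)
         true_expr (fed_call v S (Cdr ws)))
       nil_expr)"

definition valid_body :: expr where
  "valid_body = (let vl = Arg 0; ws = Arg 1; B = Arg 2; e = Arg 3;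
       v = Car (Car vl); l = Cdr (Car vl) in
     Cond (IsCons vl)
       (Cond
         (Cond (mem_call v (Car e))
           (Cond (IsCons l) true_expr
             (Cond (EqAtom l (Quote (Sym 0)))
               (Cond (fed_call v (Cdr e) ws) nil_expr true_expr)
               (Cond (mem_call v B) true_expr (fed_call v (Car e) ws))))
           true_expr)
         (valid_call (Cdr vl) ws B e)
         nil_expr)
       true_expr)"

definition lits_body :: expr where
  "lits_body = (let vl = Arg 0; S = Arg 1; v = Car (Car vl); l = Cdr (Car vl) in
     Cond (IsCons vl)
       (Cond (Cond (IsCons l) (mem_call v S) nil_expr)
         (MkCons (Cdr l) (lits_call (Cdr vl) S))
         (lits_call (Cdr vl) S))
       nil_expr)"

text \<open>Without numbers, two weights are compared by walking down two lists in parallel.\<close>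

definition le_body :: expr where
  "le_body = (let xs = Arg 0; ys = Arg 1 in
     Cond (IsCons xs) (Cond (IsCons ys) (le_call (Cdr xs) (Cdr ys)) nil_expr) true_expr)"

definition sig_eq_body :: expr where
  "sig_eq_body = (let ws = Arg 0; B = Arg 1; e = Arg 2; e' = Arg 3; v = Car B in
     Cond (IsCons B)
       (Cond (EqAtom (mem_call v (Car e)) (mem_call v (Car e')))
         (Cond (EqAtom (mem_call v (Cdr e)) (mem_call v (Cdr e')))
           (Cond (EqAtom (fed_call v (Car e) ws) (fed_call v (Car e') ws))
             (sig_eq_call ws (Cdr B) e e')
             nil_expr)
           nil_expr)
         nil_expr)
       true_expr)"

definition ins_body :: expr where
  "ins_body = (let vl = Arg 0; ws = Arg 1; B = Arg 2; e = Arg 3; R = Arg 4 in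
     Cond (IsCons R)
       (Cond (sig_eq_call ws B e (Car R))
         (Cond (le_call (lits_call vl (Car e)) (lits_call vl (Car (Car R))))
           (MkCons e (Cdr R)) R)
         (MkCons (Car R) (ins_call vl ws B e (Cdr R))))
       (MkCons e nil_expr))"

definition reduce_body :: expr where
  "reduce_body = (let vl = Arg 0; ws = Arg 1; B = Arg 2; L = Arg 3 in
     Cond (IsCons L)
       (Cond (valid_call vl ws B (Car L))
         (ins_call vl ws B (Car L) (reduce_call vl ws B (Cdr L)))
         (reduce_call vl ws B (Cdr L)))
       nil_expr)"

definition append_body :: expr where
  "append_body = (let xs = Arg 0; ys = Arg 1 in
     Cond (IsCons xs) (MkCons (Car xs) (append_call (Cdr xs) ys)) ys)"

definition joins_body :: expr where
  "joins_body = (let e = Arg 0; L = Arg 1 in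
     Cond (IsCons L)
       (MkCons
         (MkCons (append_call (Car e) (Car (Car L))) (append_call (Cdr e) (Cdr (Car L))))
         (joins_call e (Cdr L)))
       nil_expr)"

definition product_body :: expr where
  "product_body = (let L = Arg 0; L' = Arg 1 in
     Cond (IsCons L)
       (append_call (joins_call (Car L) L') (product_call (Cdr L) L'))
       nil_expr)"

definition cands_body :: expr where
  "cands_body = (let r = Arg 0; vs = Arg 1; v = MkCons (Car vs) nil_expr in
     Cond (IsCons vs)
       (product_call
         (MkCons (MkCons v nil_expr) (MkCons (MkCons nil_expr v) nil_expr))
         (cands_call r (Cdr vs)))
       (MkCons (MkCons (MkCons r nil_expr) nil_expr) nil_expr))"

text \<open>The neighbour itself serves as truth value in \<open>tab_body\<close>: a symbol differs
  from \<open>SNil\<close>, also for node 0.\<close>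

definition pick_body :: expr where
  "pick_body = (let E = Arg 0; i = Arg 1; a = Car (Car E); b = Cdr (Car E) in
     Cond (IsCons E)
       (Cond (EqAtom i a) b (Cond (EqAtom i b) a (pick_call (Cdr E) i)))
       nil_expr)"

definition del_body :: expr where
  "del_body = (let E = Arg 0; i = Arg 1; a = Car (Car E); b = Cdr (Car E) in
     Cond (IsCons E)
       (Cond (EqAtom i a) (Cdr E)
         (Cond (EqAtom i b) (Cdr E) (MkCons (Car E) (del_call (Cdr E) i))))
       nil_expr)"

definition bag_body :: expr where
  "bag_body = (let ns = Arg 0; i = Arg 1 in
     Cond (IsCons ns)
       (Cond (EqAtom i (Car (Car ns))) (Cdr (Car ns)) (bag_call (Cdr ns) i))
       nil_expr)"

definition tab_body :: expr where
  "tab_body = (let x = Arg 0; ns = Arg 1; E = Arg 2; i = Arg 3 in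
     reduce_call (Car (Cdr x)) (Cdr (Cdr x)) (bag_call ns i)
       (Cond (pick_call E i)
         (product_call (tab_call x ns (del_call E i) i)
           (tab_call x ns (del_call E i) (pick_call E i)))
         (cands_call (Car x) (bag_call ns i))))"

text \<open>With an empty bag all partial solutions have the same signature, so \<open>reduce\<close> leaves only one.\<close>

definition main_body :: expr where
  "main_body = (let x = Arg 0; y = Arg 1; vl = Car (Cdr x); ws = Cdr (Cdr x) in
     lits_call vl
       (Car (Car (reduce_call vl ws nil_expr
         (tab_call x (Car y) (Cdr y) (Car (Car (Car y))))))))"

definition prog :: program where
  "prog = [main_body, mem_body, fed_body, valid_body, lits_body, le_body, sig_eq_body, ins_body,
     reduce_body, append_body, joins_body, product_body, cands_body, pick_body, del_body,
     bag_body, tab_body]"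

text \<open>An upper bound instead of the exact count, so that bounds can be rounded up and
  composed.\<close>

definition runs :: "nat \<Rightarrow> sexp list \<Rightarrow> sexp \<Rightarrow> nat \<Rightarrow> bool" where
  "runs f vs v b \<longleftrightarrow> wp_call prog f vs (\<lambda>w n. w = v \<and> n \<le> b)"

text \<open>Replaces a call by its specification. The continuation must accept every step count up
  to the bound, since the exact one is forgotten.\<close>

lemma runs_call:
  assumes "runs f vs v b" "\<And>n. n \<le> b \<Longrightarrow> Q v n"
  shows "wp_call prog f vs Q"
  using assms unfolding runs_def wp_call_def wp_def by blast

lemma runs_mono: "runs f vs v b \<Longrightarrow> b \<le> c \<Longrightarrow> runs f vs v c"
  by (auto simp: runs_def[of f vs v c] intro: runs_call)

lemma runs_unfold:
  "runs 0 vs v b = wp prog vs main_body (\<lambda>w n. w = v \<and> n \<le> b)"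
  "runs (Suc 0) vs v b = wp prog vs mem_body (\<lambda>w n. w = v \<and> n \<le> b)"
  "runs 2 vs v b = wp prog vs fed_body (\<lambda>w n. w = v \<and> n \<le> b)"
  "runs 3 vs v b = wp prog vs valid_body (\<lambda>w n. w = v \<and> n \<le> b)"
  "runs 4 vs v b = wp prog vs lits_body (\<lambda>w n. w = v \<and> n \<le> b)"
  "runs 5 vs v b = wp prog vs le_body (\<lambda>w n. w = v \<and> n \<le> b)"
  "runs 6 vs v b = wp prog vs sig_eq_body (\<lambda>w n. w = v \<and> n \<le> b)"
  "runs 7 vs v b = wp prog vs ins_body (\<lambda>w n. w = v \<and> n \<le> b)"
  "runs 8 vs v b = wp prog vs reduce_body (\<lambda>w n. w = v \<and> n \<le> b)"
  "runs 9 vs v b = wp prog vs append_body (\<lambda>w n. w = v \<and> n \<le> b)"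
  "runs 10 vs v b = wp prog vs joins_body (\<lambda>w n. w = v \<and> n \<le> b)"
  "runs 11 vs v b = wp prog vs product_body (\<lambda>w n. w = v \<and> n \<le> b)"
  "runs 12 vs v b = wp prog vs cands_body (\<lambda>w n. w = v \<and> n \<le> b)"
  "runs 13 vs v b = wp prog vs pick_body (\<lambda>w n. w = v \<and> n \<le> b)"
  "runs 14 vs v b = wp prog vs del_body (\<lambda>w n. w = v \<and> n \<le> b)"
  "runs 15 vs v b = wp prog vs bag_body (\<lambda>w n. w = v \<and> n \<le> b)"
  "runs 16 vs v b = wp prog vs tab_body (\<lambda>w n. w = v \<and> n \<le> b)"
  by (simp_all add: runs_def wp_call_def prog_def)

lemma enc_list_simps [simp]:
  "enc_list f [] = SNil" "enc_list f (x # xs) = SCons (f x) (enc_list f xs)"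
  by (simp_all add: enc_list_def)

lemma truth_eq_SNil [simp]: "truth p = SNil \<longleftrightarrow> \<not> p" "truth p = Sym 0 \<longleftrightarrow> p"
  by simp_all

text \<open>Makes \<open>EqAtom\<close> an equivalence of truth values, which is how signatures are
  compared bit by bit.\<close>

lemma eq_atom_truth [simp]: "eq_atom (truth p) (truth q) \<longleftrightarrow> p = q"
  by simp

lemma mem_runs: "runs (Suc 0) [Sym a, enc_list Sym xs] (truth (a \<in> set xs)) (20 * (length xs + 1))"
proof (induction xs)
  case Nil
  show ?case by (simp add: runs_unfold mem_body_def Let_def)
next
  case (Cons x xs)
  show ?case
    by (auto simp: runs_unfold mem_body_def Let_def intro!: runs_call[OF Cons])
qed

section \<open>What the program computes\<close>

definition fed :: "(nat \<times> nat) set \<Rightarrow> nat \<Rightarrow> nat set \<Rightarrow> bool" where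
  "fed W v S \<longleftrightarrow> (\<exists>u\<in>S. (u, v) \<in> W)"

text \<open>\<open>S\<close> holds the chosen and \<open>Z\<close> the rejected vertices; vertices in neither are not decided yet. An
  OR-gate in \<open>B\<close> may still receive its chosen input later.\<close>

definition valid ::
  "(nat \<Rightarrow> label) \<Rightarrow> nat set \<Rightarrow> (nat \<times> nat) set \<Rightarrow> nat set \<Rightarrow> nat set \<Rightarrow> nat set \<Rightarrow> bool" where
  "valid lb V W B S Z \<longleftrightarrow>
     (\<forall>v\<in>V. v \<in> S \<longrightarrow> (lb v = And \<longrightarrow> \<not> fed W v Z) \<and> (lb v = Or \<longrightarrow> v \<in> B \<or> fed W v S))"

fun var_of :: "label \<Rightarrow> nat" where
  "var_of (Lit x b) = x"
| "var_of _ = 0"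

text \<open>Runs through the vertices of the circuit and only tests membership in \<open>S\<close>,
  so that repetitions in the lists of an entry are not counted twice.\<close>

definition lits :: "(nat \<Rightarrow> label) \<Rightarrow> nat list \<Rightarrow> nat set \<Rightarrow> nat list" where
  "lits lb vs S = map (\<lambda>v. var_of (lb v)) (filter (\<lambda>v. is_lit (lb v) \<and> v \<in> S) vs)"

type_synonym entry = "nat list \<times> nat list"

definition sig :: "(nat \<times> nat) set \<Rightarrow> nat list \<Rightarrow> entry \<Rightarrow> (bool \<times> bool \<times> bool) list" where
  "sig W B e = map (\<lambda>v. (v \<in> set (fst e), v \<in> set (snd e), fed W v (set (fst e)))) B"

fun insert_best :: "('a \<Rightarrow> 'k) \<Rightarrow> ('a \<Rightarrow> nat) \<Rightarrow> 'a \<Rightarrow> 'a list \<Rightarrow> 'a list" where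
  "insert_best key w e [] = [e]"
| "insert_best key w e (x # xs) =
     (if key e = key x then (if w e \<le> w x then e # xs else x # xs)
      else x # insert_best key w e xs)"

fun best_by :: "('a \<Rightarrow> 'k) \<Rightarrow> ('a \<Rightarrow> nat) \<Rightarrow> 'a list \<Rightarrow> 'a list" where
  "best_by key w [] = []"
| "best_by key w (e # L) = insert_best key w e (best_by key w L)"

definition entry_weight :: "(nat \<Rightarrow> label) \<Rightarrow> nat list \<Rightarrow> entry \<Rightarrow> nat" where
  "entry_weight lb vs e = length (lits lb vs (set (fst e)))"

definition reduce ::
  "(nat \<Rightarrow> label) \<Rightarrow> nat list \<Rightarrow> (nat \<times> nat) set \<Rightarrow> nat list \<Rightarrow> entry list \<Rightarrow> entry list" where
  "reduce lb vs W B L = best_by (sig W B) (entry_weight lb vs)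
     (filter (\<lambda>e. valid lb (set vs) W (set B) (set (fst e)) (set (snd e))) L)"

definition join :: "entry \<Rightarrow> entry \<Rightarrow> entry" where
  "join e e' = (fst e @ fst e', snd e @ snd e')"

definition joins :: "entry list \<Rightarrow> entry list \<Rightarrow> entry list" where
  "joins L L' = concat (map (\<lambda>e. map (join e) L') L)"

text \<open>The output \<open>r\<close> is chosen in every candidate, so that \<open>valid\<close> forbids to reject one of its inputs.\<close>

fun cands :: "nat \<Rightarrow> nat list \<Rightarrow> entry list" where
  "cands r [] = [([r], [])]"
| "cands r (v # vs) = joins [([v], []), ([], [v])] (cands r vs)"

fun pick :: "(nat \<times> nat) list \<Rightarrow> nat \<Rightarrow> nat option" where
  "pick [] i = None"
| "pick ((a, b) # E) i = (if i = a then Some b else if i = b then Some a else pick E i)"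

text \<open>Stops at the same edge as \<open>pick\<close>, hence removes precisely the edge that was
  followed.\<close>

fun del :: "(nat \<times> nat) list \<Rightarrow> nat \<Rightarrow> (nat \<times> nat) list" where
  "del [] i = []"
| "del ((a, b) # E) i = (if i = a \<or> i = b then E else (a, b) # del E i)"

abbreviation enc_nats :: "nat list \<Rightarrow> sexp" where
  "enc_nats \<equiv> enc_list Sym"

definition enc_entry :: "entry \<Rightarrow> sexp" where
  "enc_entry e = SCons (enc_nats (fst e)) (enc_nats (snd e))"

abbreviation enc_verts :: "(nat \<Rightarrow> label) \<Rightarrow> nat list \<Rightarrow> sexp" where
  "enc_verts lb \<equiv> enc_list (\<lambda>v. SCons (Sym v) (enc_label (lb v)))"

lemma enc_entry_simps [simp]:
  "car (enc_entry e) = enc_nats (fst e)" "cdr (enc_entry e) = enc_nats (snd e)"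
  "enc_entry e \<noteq> SNil"
  by (simp_all add: enc_entry_def)

lemma enc_pair_simps [simp]: "car (enc_pair w) = Sym (fst w)" "cdr (enc_pair w) = Sym (snd w)"
  by (simp_all add: enc_pair_def)

lemma is_cons_enc_label [simp]: "is_cons (enc_label l) \<longleftrightarrow> is_lit l"
  by (cases l) (simp_all add: is_lit_def)

lemma cdr_enc_label [simp]: "is_lit l \<Longrightarrow> cdr (enc_label l) = Sym (var_of l)"
  by (cases l) (simp_all add: is_lit_def)

lemma eq_atom_enc_label [simp]: "eq_atom (enc_label l) (Sym 0) \<longleftrightarrow> l = And"
  by (cases l) simp_all

lemma not_is_lit [simp]: "\<not> is_lit And" "\<not> is_lit Or"
  by (simp_all add: is_lit_def)

lemma not_is_lit_cases: "\<not> is_lit l \<Longrightarrow> l \<noteq> And \<Longrightarrow> l = Or"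
  by (cases l) (simp_all add: is_lit_def)

section \<open>Running times of the auxiliary functions\<close>

text \<open>Costs are coarsened to multiples of one variable \<open>q\<close> above
  \<open>m * m\<close>; after symbolic evaluation only linear inequalities between monomials
  remain.\<close>

lemma mem_runs_le:
  assumes "length xs < m" "m * m \<le> q"
  shows "runs (Suc 0) [Sym a, enc_nats xs] (truth (a \<in> set xs)) (20 * q)"
proof (rule runs_mono[OF mem_runs])
  show "20 * (length xs + 1) \<le> 20 * q"
    using assms(1) order_trans[OF le_square[of m] assms(2)] by simp
qed

lemma fed_runs:
  assumes "length S < m"
  shows "runs 2 [Sym v, enc_nats S, enc_list enc_pair ws] (truth (fed (set ws) v (set S)))
    ((length ws + 1) * (20 * m + 30))"
proof (induction ws arbitrary: v)
  case Nil
  show ?case by (simp add: runs_unfold fed_body_def Let_def fed_def)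
next
  case (Cons w ws)
  have m: "runs (Suc 0) [Sym a, enc_nats S] (truth (a \<in> set S)) (20 * m)" for a
    using assms by (intro runs_mono[OF mem_runs]) simp
  have eq: "fed (set (w # ws)) v (set S) \<longleftrightarrow> snd w = v \<and> fst w \<in> set S \<or> fed (set ws) v (set S)"
    by (cases w) (auto simp: fed_def)
  show ?case
    unfolding eq
    by (auto simp: runs_unfold fed_body_def Let_def algebra_simps intro!: runs_call[OF Cons] runs_call[OF m])
qed

lemma fed_runs_le:
  assumes "length S < m" "length ws < m" "m * m \<le> q"
  shows "runs 2 [Sym v, enc_nats S, enc_list enc_pair ws] (truth (fed (set ws) v (set S))) (50 * q)"
proof (rule runs_mono[OF fed_runs[OF assms(1)]])
  have "(length ws + 1) * (20 * m + 30) \<le> m * (50 * m)"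
    using assms by (intro mult_le_mono) auto
  also have "\<dots> \<le> 50 * q"
    using assms(3) by simp
  finally show "(length ws + 1) * (20 * m + 30) \<le> 50 * q" .
qed

lemma valid_runs:
  assumes "length S < m" "length Z < m" "length ws < m" "length B < m" "m * m \<le> q"
  shows "runs 3 [enc_verts lb vs, enc_list enc_pair ws, enc_nats B, enc_entry (S, Z)]
    (truth (valid lb (set vs) (set ws) (set B) (set S) (set Z)))
    ((length vs + 1) * (200 * q))"
proof (induction vs)
  case Nil
  have "1 \<le> q" using assms by (cases m) auto
  then show ?case by (simp add: runs_unfold valid_body_def Let_def valid_def)
next
  case (Cons v vs)
  have q: "1 \<le> q" using assms by (cases m) auto
  have eq: "valid lb (set (v # vs)) (set ws) (set B) (set S) (set Z) \<longleftrightarrow>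
    (v \<in> set S \<longrightarrow> (lb v = And \<longrightarrow> \<not> fed (set ws) v (set Z)) \<and>
       (lb v = Or \<longrightarrow> v \<in> set B \<or> fed (set ws) v (set S))) \<and>
    valid lb (set vs) (set ws) (set B) (set S) (set Z)"
    by (auto simp: valid_def)
  show ?case
    using q unfolding eq
    by (auto simp: runs_unfold valid_body_def Let_def algebra_simps dest: not_is_lit_cases
        intro!: runs_call[OF Cons] runs_call[OF mem_runs_le[OF assms(1,5)]]
          runs_call[OF mem_runs_le[OF assms(4,5)]] runs_call[OF fed_runs_le[OF assms(1,3,5)]]
          runs_call[OF fed_runs_le[OF assms(2,3,5)]])
qed

lemma lits_runs:
  assumes "length S < m" "m * m \<le> q"
  shows "runs 4 [enc_verts lb vs, enc_nats S] (enc_nats (lits lb vs (set S)))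
    ((length vs + 1) * (50 * q))"
proof (induction vs)
  case Nil
  have "1 \<le> q" using assms by (cases m) auto
  then show ?case by (simp add: runs_unfold lits_body_def Let_def lits_def)
next
  case (Cons v vs)
  have q: "1 \<le> q" using assms by (cases m) auto
  have eq: "lits lb (v # vs) (set S) = (if is_lit (lb v) \<and> v \<in> set S
    then var_of (lb v) # lits lb vs (set S) else lits lb vs (set S))"
    by (auto simp: lits_def)
  show ?case
    using q unfolding eq
    by (auto simp: runs_unfold lits_body_def Let_def algebra_simps
        intro!: runs_call[OF Cons] runs_call[OF mem_runs_le[OF assms]])
qed

lemma le_runs:
  "runs 5 [enc_nats xs, enc_nats ys] (truth (length xs \<le> length ys)) (20 * (length xs + 1))"
proof (induction xs arbitrary: ys)
  case Nil
  show ?case by (simp add: runs_unfold le_body_def Let_def)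
next
  case (Cons x xs)
  show ?case
    by (cases ys) (auto simp: runs_unfold le_body_def Let_def intro!: runs_call[OF Cons])
qed

text \<open>Per bag vertex there are four membership tests at \<open>20 * q\<close> and two
  \<open>fed\<close> tests at \<open>50 * q\<close>; the rest of \<open>240 * q\<close> absorbs the
  constant overhead.\<close>

lemma sig_eq_runs:
  assumes "length S < m" "length Z < m" "length S' < m" "length Z' < m" "length ws < m" "m * m \<le> q"
  shows "runs 6 [enc_list enc_pair ws, enc_nats B, enc_entry (S, Z), enc_entry (S', Z')]
    (truth (sig (set ws) B (S, Z) = sig (set ws) B (S', Z'))) ((length B + 1) * (240 * q))"
proof (induction B)
  case Nil
  have "1 \<le> q" using assms by (cases m) auto
  then show ?case by (simp add: runs_unfold sig_eq_body_def Let_def sig_def)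
next
  case (Cons v B)
  have q: "1 \<le> q" using assms by (cases m) auto
  have eq: "sig (set ws) (v # B) (S, Z) = sig (set ws) (v # B) (S', Z') \<longleftrightarrow>
    (v \<in> set S \<longleftrightarrow> v \<in> set S') \<and> (v \<in> set Z \<longleftrightarrow> v \<in> set Z') \<and>
    (fed (set ws) v (set S) \<longleftrightarrow> fed (set ws) v (set S')) \<and>
    sig (set ws) B (S, Z) = sig (set ws) B (S', Z')"
    by (auto simp: sig_def)
  show ?case
    using q unfolding eq
    by (auto simp: runs_unfold sig_eq_body_def Let_def algebra_simps
        intro!: runs_call[OF Cons] runs_call[OF mem_runs_le[OF assms(1,6)]]
          runs_call[OF mem_runs_le[OF assms(2,6)]] runs_call[OF mem_runs_le[OF assms(3,6)]]
          runs_call[OF mem_runs_le[OF assms(4,6)]] runs_call[OF fed_runs_le[OF assms(1,5,6)]]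
          runs_call[OF fed_runs_le[OF assms(3,5,6)]])
qed

section \<open>Keeping one lightest entry per key\<close>

lemma set_insert_best: "set (insert_best key w e R) \<subseteq> insert e (set R)"
  by (induction R) auto

lemma set_best_by: "set (best_by key w L) \<subseteq> set L"
  using set_insert_best by (induction L) fastforce+

lemma key_insert_best: "key ` set (insert_best key w e R) = insert (key e) (key ` set R)"
  by (induction R) auto

lemma distinct_insert_best:
  "distinct (map key R) \<Longrightarrow> distinct (map key (insert_best key w e R))"
proof (induction R)
  case (Cons x R)
  moreover have "key x \<notin> key ` set (insert_best key w e R)" if "key e \<noteq> key x"
    unfolding key_insert_best using that Cons.prems by auto
  ultimately show ?case by auto
qed simp

lemma distinct_best_by: "distinct (map key (best_by key w L))"
  by (induction L) (simp_all add: distinct_insert_best)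

lemma insert_best_dominates:
  assumes "x = e \<or> x \<in> set R"
  shows "\<exists>y\<in>set (insert_best key w e R). key y = key x \<and> w y \<le> w x"
  using assms
proof (induction R)
  case (Cons a R)
  then show ?case
    by (cases "key e = key a") (auto intro: order_trans[of _ "w a"] nat_le_linear)
qed auto

lemma best_by_dominates:
  "x \<in> set L \<Longrightarrow> \<exists>y\<in>set (best_by key w L). key y = key x \<and> w y \<le> w x"
proof (induction L)
  case (Cons e L)
  show ?case
  proof (cases "x = e")
    case True
    then show ?thesis using insert_best_dominates[of e e "best_by key w L" key w] by simp
  next
    case False
    then obtain y where "y \<in> set (best_by key w L)" "key y = key x" "w y \<le> w x"
      using Cons by auto
    \<comment> \<open>The insertion may displace \<open>y\<close>, but only in favour of an entry
      with the same key that is no heavier.\<close>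
    then show ?thesis
      using insert_best_dominates[of y e "best_by key w L" key w] by fastforce
  qed
qed simp

lemma reduce_simps [simp]:
  "reduce lb vs W B [] = []"
  "reduce lb vs W B (e # L) =
    (if valid lb (set vs) W (set B) (set (fst e)) (set (snd e))
     then insert_best (sig W B) (entry_weight lb vs) e (reduce lb vs W B L) else reduce lb vs W B L)"
  by (simp_all add: reduce_def)

lemma set_reduce:
  "set (reduce lb vs W B L) \<subseteq> {e \<in> set L. valid lb (set vs) W (set B) (set (fst e)) (set (snd e))}"
  unfolding reduce_def using set_best_by by fastforce

text \<open>The surviving entries have pairwise distinct signatures, and a signature is a word of
  length \<open>length B\<close> over an alphabet of eight letters.\<close>

lemma length_reduce_le: "length (reduce lb vs W B L) \<le> 8 ^ length B"
proof -
  let ?R = "reduce lb vs W B L"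
  have "distinct (map (sig W B) ?R)"
    unfolding reduce_def by (rule distinct_best_by)
  then have "length ?R = card (set (map (sig W B) ?R))"
    by (metis distinct_card length_map)
  also have "\<dots> \<le> card {xs. set xs \<subseteq> (UNIV :: (bool \<times> bool \<times> bool) set) \<and> length xs = length B}"
    by (rule card_mono[OF finite_lists_length_eq]) (auto simp: sig_def)
  also have "\<dots> = 8 ^ length B"
    by (subst card_lists_length_eq) (simp_all add: card_cartesian_product flip: UNIV_Times_UNIV)
  finally show ?thesis .
qed

definition small :: "nat \<Rightarrow> entry \<Rightarrow> bool" where
  "small m e \<longleftrightarrow> length (fst e) < m \<and> length (snd e) < m"

text \<open>Per entry of \<open>R\<close>: \<open>240 * r\<close> for comparing signatures, twice
  \<open>50 * r\<close> for listing literals, \<open>20 * r\<close> for comparing lengths. The cube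
  below \<open>r\<close> comes from scanning \<open>vs\<close> or \<open>B\<close> with tests that
  are quadratic in \<open>m\<close>.\<close>

lemma ins_runs:
  assumes "small m e" "\<forall>x\<in>set R. small m x"
    and len: "length vs < m" "length ws < m" "length B < m" and r: "m * (m * m) \<le> r"
  shows "runs 7 [enc_verts lb vs, enc_list enc_pair ws, enc_nats B, enc_entry e,
      enc_list enc_entry R]
    (enc_list enc_entry (insert_best (sig (set ws) B) (entry_weight lb vs) e R))
    ((length R + 1) * (450 * r))"
proof -
  have m: "Suc 0 \<le> m" "m \<le> r" "1 \<le> r"
    using len(1) le_square[of m] r by (auto intro: order_trans[OF _ r])
  have lits: "runs 4 [enc_verts lb vs, enc_nats S] (enc_nats (lits lb vs (set S))) (50 * r)"
    if "length S < m" for S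
    using mult_le_mono[of "length vs + 1" m "50 * (m * m)" "50 * (m * m)"] len(1) r
    by (intro runs_mono[OF lits_runs[OF that order_refl]]) linarith
  have le: "runs 5 [enc_nats (lits lb vs S), enc_nats ys] (truth (length (lits lb vs S) \<le> length ys)) (20 * r)"
    for S ys
  proof (rule runs_mono[OF le_runs])
    have "length (lits lb vs S) < m"
      using le_less_trans[OF length_filter_le len(1)] by (simp add: lits_def)
    then show "20 * (length (lits lb vs S) + 1) \<le> 20 * r" using m by simp
  qed
  have sig: "runs 6 [enc_list enc_pair ws, enc_nats B, enc_entry e, enc_entry e']
    (truth (sig (set ws) B e = sig (set ws) B e')) (240 * r)" if "small m e'" for e'
    using sig_eq_runs[of "fst e" m "snd e" "fst e'" "snd e'" ws "m * m" B] assms(1) that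
      mult_le_mono[of "length B + 1" m "240 * (m * m)" "240 * (m * m)"] len(3) r len(2)
    by (intro runs_mono[where c = "240 * r"]) (auto simp: small_def)
  have small: "length (fst e) < m" using assms(1) by (simp add: small_def)
  from assms(2) show ?thesis
  proof (induction R)
    case Nil
    show ?case using m by (simp add: runs_unfold ins_body_def Let_def)
  next
    case (Cons x R)
    have x: "small m x" "length (fst x) < m" using Cons.prems by (simp_all add: small_def)
    have IH: "runs 7 [enc_verts lb vs, enc_list enc_pair ws, enc_nats B, enc_entry e,
        enc_list enc_entry R]
      (enc_list enc_entry (insert_best (sig (set ws) B) (entry_weight lb vs) e R))
      ((length R + 1) * (450 * r))"
      using Cons by simp
    show ?case
      using m
      by (auto simp: runs_unfold ins_body_def Let_def algebra_simps entry_weight_def[symmetric]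
          intro!: runs_call[OF IH] runs_call[OF sig[OF x(1)]] runs_call[OF lits[OF small]]
            runs_call[OF lits[OF x(2)]] runs_call[OF le])
  qed
qed

text \<open>Every insertion goes into the already reduced tail, which has at most \<open>K\<close>
  entries however long \<open>L\<close> is. So the time is linear in \<open>length L\<close>, with a
  factor \<open>K + 1\<close> per entry.\<close>

lemma reduce_runs:
  assumes "\<forall>x\<in>set L. small m x"
    and len: "length vs < m" "length ws < m" "length B < m" and r: "m * (m * m) \<le> r"
    and K: "8 ^ length B \<le> K"
  shows "runs 8 [enc_verts lb vs, enc_list enc_pair ws, enc_nats B, enc_list enc_entry L]
    (enc_list enc_entry (reduce lb vs (set ws) B L)) ((length L + 1) * ((K + 1) * (700 * r)))"
  using assms(1)
proof (induction L)
  case Nil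
  have "1 \<le> r" using len(1) r by (cases m) auto
  then show ?case by (simp add: runs_unfold reduce_body_def Let_def algebra_simps)
next
  case (Cons e L)
  have r1: "1 \<le> r" using len(1) r by (cases m) auto
  have valid: "runs 3 [enc_verts lb vs, enc_list enc_pair ws, enc_nats B, enc_entry e]
    (truth (valid lb (set vs) (set ws) (set B) (set (fst e)) (set (snd e)))) (200 * r)"
    using valid_runs[of "fst e" m "snd e" ws B "m * m" lb vs] Cons.prems
      mult_le_mono[of "length vs + 1" m "200 * (m * m)" "200 * (m * m)"] len r
    by (intro runs_mono[where c = "200 * r"]) (auto simp: small_def)
  define R where "R = reduce lb vs (set ws) B L"
  have R: "length R \<le> K" "\<forall>x\<in>set R. small m x"
    unfolding R_def using length_reduce_le[of lb vs "set ws" B L] K set_reduce[of lb vs "set ws" B L] Cons.prems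
    by (fastforce)+
  have IH: "runs 8 [enc_verts lb vs, enc_list enc_pair ws, enc_nats B, enc_list enc_entry L]
    (enc_list enc_entry R) ((length L + 1) * ((K + 1) * (700 * r)))"
    unfolding R_def using Cons by simp
  have ins: "runs 7 [enc_verts lb vs, enc_list enc_pair ws, enc_nats B, enc_entry e, enc_list enc_entry R]
    (enc_list enc_entry (insert_best (sig (set ws) B) (entry_weight lb vs) e R)) ((K + 1) * (450 * r))"
    using Cons.prems R len r
    by (intro runs_mono[OF ins_runs[of m]]) auto
  show ?case
    using r1
    by (auto simp: runs_unfold reduce_body_def Let_def algebra_simps R_def[symmetric]
        intro!: runs_call[OF IH] runs_call[OF valid] runs_call[OF ins])
qed

lemma append_runs:
  "runs 9 [enc_list f xs, enc_list f ys] (enc_list f (xs @ ys)) (20 * (length xs + 1))"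
proof (induction xs)
  case Nil
  show ?case by (simp add: runs_unfold append_body_def Let_def)
next
  case (Cons x xs)
  show ?case
    by (auto simp: runs_unfold append_body_def Let_def intro!: runs_call[OF Cons])
qed

lemma joins_runs:
  assumes "small m e"
  shows "runs 10 [enc_entry e, enc_list enc_entry L] (enc_list enc_entry (map (join e) L))
    ((length L + 1) * (100 * m))"
proof (induction L)
  case Nil
  show ?case using assms by (simp add: runs_unfold joins_body_def Let_def small_def)
next
  case (Cons x L)
  have app: "runs 9 [enc_nats xs, enc_nats ys] (enc_nats (xs @ ys)) (20 * m)"
    if "length xs < m" for xs ys
    using that by (intro runs_mono[OF append_runs]) simp
  have e: "length (fst e) < m" "length (snd e) < m" using assms by (simp_all add: small_def)
  show ?case
    using e
    by (auto simp: runs_unfold joins_body_def Let_def algebra_simps join_def enc_entry_def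
        intro!: runs_call[OF Cons[unfolded enc_entry_def]] runs_call[OF app[OF e(1)]] runs_call[OF app[OF e(2)]])
qed

lemma product_runs:
  assumes "\<forall>e\<in>set L. small m e" "1 \<le> m"
  shows "runs 11 [enc_list enc_entry L, enc_list enc_entry L'] (enc_list enc_entry (joins L L'))
    ((length L + 1) * ((length L' + 1) * (170 * m)))"
  using assms(1)
proof (induction L)
  case Nil
  show ?case using assms(2) by (simp add: runs_unfold product_body_def Let_def joins_def algebra_simps)
next
  case (Cons e L)
  have IH: "runs 11 [enc_list enc_entry L, enc_list enc_entry L'] (enc_list enc_entry (joins L L'))
    ((length L + 1) * ((length L' + 1) * (170 * m)))" using Cons by simp
  have eq: "joins (e # L) L' = map (join e) L' @ joins L L'" by (simp add: joins_def)
  have app: "runs 9 [enc_list enc_entry (map (join e) L'), enc_list enc_entry (joins L L')]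
    (enc_list enc_entry (map (join e) L' @ joins L L')) ((length L' + 1) * (20 * m))"
    using assms(2) mult_le_mono[of "length L' + 1" "length L' + 1" 20 "20 * m"]
    by (intro runs_mono[OF append_runs]) (simp add: algebra_simps)
  have "small m e" using Cons.prems by simp
  show ?case
    unfolding eq using assms(2)
    by (auto simp: runs_unfold product_body_def Let_def algebra_simps
        intro!: runs_call[OF IH] runs_call[OF joins_runs[OF \<open>small m e\<close>]] runs_call[OF app])
qed

lemma length_joins: "length (joins L L') = length L * length L'"
  by (simp add: joins_def length_concat comp_def sum_list_triv)

lemma length_cands: "length (cands r vs) = 2 ^ length vs"
  by (induction vs) (simp_all add: length_joins)

lemma cands_runs:
  assumes "2 \<le> m"
  shows "runs 12 [Sym r, enc_nats vs] (enc_list enc_entry (cands r vs))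
    ((length vs + 1) * ((2 ^ length vs + 1) * (600 * m)))"
proof (induction vs)
  case Nil
  show ?case using assms by (simp add: runs_unfold cands_body_def Let_def enc_entry_def)
next
  case (Cons v vs)
  have prod: "runs 11 [enc_list enc_entry [([v], []), ([], [v])], enc_list enc_entry (cands r vs)]
    (enc_list enc_entry (cands r (v # vs))) (3 * ((2 ^ length vs + 1) * (170 * m)))"
    using product_runs[of "[([v], []), ([], [v])]" m "cands r vs"] assms
    by (simp add: small_def length_cands algebra_simps)
  have m2: "m \<le> 2 ^ length vs * m" by simp
  show ?case
    using assms m2
    by (auto simp: runs_unfold cands_body_def Let_def algebra_simps enc_entry_def simp del: cands.simps
        intro!: runs_call[OF Cons[unfolded enc_entry_def]]
          runs_call[OF prod[unfolded enc_entry_def, simplified enc_list_simps fst_conv snd_conv]])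
qed

lemma pick_runs:
  "runs 13 [enc_list enc_pair E, Sym i] (case pick E i of None \<Rightarrow> SNil | Some k \<Rightarrow> Sym k)
    (40 * (length E + 1))"
proof (induction E)
  case Nil
  show ?case by (simp add: runs_unfold pick_body_def Let_def)
next
  case (Cons p E)
  show ?case
    by (cases p) (auto simp: runs_unfold pick_body_def Let_def intro!: runs_call[OF Cons])
qed

lemma del_runs:
  "runs 14 [enc_list enc_pair E, Sym i] (enc_list enc_pair (del E i)) (40 * (length E + 1))"
proof (induction E)
  case Nil
  show ?case by (simp add: runs_unfold del_body_def Let_def)
next
  case (Cons p E)
  show ?case
    by (cases p) (auto simp: runs_unfold del_body_def Let_def intro!: runs_call[OF Cons])
qed

lemma bag_runs:
  "i \<in> set ns \<Longrightarrow>
    runs 15 [enc_list (\<lambda>i. SCons (Sym i) (enc_nats (bs i))) ns, Sym i] (enc_nats (bs i))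
      (40 * (length ns + 1))"
proof (induction ns)
  case (Cons j ns)
  show ?case
  proof (cases "i = j")
    case True
    then show ?thesis by (simp add: runs_unfold bag_body_def Let_def)
  next
    case False
    with Cons have "runs 15 [enc_list (\<lambda>i. SCons (Sym i) (enc_nats (bs i))) ns, Sym i] (enc_nats (bs i))
      (40 * (length ns + 1))" by simp
    with False show ?thesis
      by (auto simp: runs_unfold bag_body_def Let_def intro!: runs_call)
  qed
qed simp

section \<open>Merging partial solutions along a separation\<close>

text \<open>Equality of signatures, stated for sets; this way an entry can be compared with an
  arbitrary solution that occurs in no list.\<close>

definition agree :: "(nat \<times> nat) set \<Rightarrow> nat set \<Rightarrow> nat set \<Rightarrow> nat set \<Rightarrow> nat set \<Rightarrow> nat set \<Rightarrow> bool" where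
  "agree W B S Z S' Z' \<longleftrightarrow>
     (\<forall>v\<in>B. (v \<in> S \<longleftrightarrow> v \<in> S') \<and> (v \<in> Z \<longleftrightarrow> v \<in> Z') \<and> (fed W v S \<longleftrightarrow> fed W v S'))"

definition lit_count :: "(nat \<Rightarrow> label) \<Rightarrow> nat set \<Rightarrow> nat set \<Rightarrow> nat" where
  "lit_count lb V S = card {v \<in> V. is_lit (lb v) \<and> v \<in> S}"

lemma length_lits: "distinct vs \<Longrightarrow> length (lits lb vs S) = lit_count lb (set vs) S"
  by (simp add: lits_def lit_count_def distinct_length_filter Int_def conj_commute)

lemma sig_eq_iff:
  "sig W B e = sig W B e' \<longleftrightarrow>
    agree W (set B) (set (fst e)) (set (snd e)) (set (fst e')) (set (snd e'))"
  by (auto simp: sig_def agree_def)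

lemma agree_trans:
  "agree W B S Z S' Z' \<Longrightarrow> agree W B S' Z' S'' Z'' \<Longrightarrow> agree W B S Z S'' Z''"
  by (simp add: agree_def)

locale gates =
  fixes lb :: "nat \<Rightarrow> label" and V :: "nat set" and W :: "(nat \<times> nat) set" and r :: nat
  assumes finite_V: "finite V" and lb_r: "lb r = And" and r_sink: "(r, v) \<notin> W"

text \<open>What remains of cutting a tree edge: two sides with the bags at the ends of the edge,
  and the output on both sides. By \<open>cross\<close>, a wire between the sides has an end in both
  bags; by \<open>closed1\<close> and \<open>closed2\<close>, a vertex outside the bag has all its
  inputs on its own side and has nothing to wait for.\<close>

locale separation = gates +
  fixes D\<^sub>1 D\<^sub>2 B\<^sub>1 B\<^sub>2 :: "nat set"
  assumes B1: "B\<^sub>1 \<subseteq> D\<^sub>1" and B2: "B\<^sub>2 \<subseteq> D\<^sub>2" and r: "r \<in> D\<^sub>1" "r \<in> D\<^sub>2" "r \<notin> B\<^sub>1" "r \<notin> B\<^sub>2"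
    and sep: "v \<in> D\<^sub>1 \<Longrightarrow> v \<in> D\<^sub>2 \<Longrightarrow> v \<noteq> r \<Longrightarrow> v \<in> B\<^sub>1 \<and> v \<in> B\<^sub>2"
    and cross: "(u, v) \<in> W \<Longrightarrow> v \<noteq> r \<Longrightarrow> u \<in> D\<^sub>1 \<and> v \<in> D\<^sub>2 \<or> u \<in> D\<^sub>2 \<and> v \<in> D\<^sub>1 \<Longrightarrow>
       u \<in> B\<^sub>1 \<and> u \<in> B\<^sub>2 \<or> v \<in> B\<^sub>1 \<and> v \<in> B\<^sub>2"
    and closed1: "(u, v) \<in> W \<Longrightarrow> v \<noteq> r \<Longrightarrow> v \<in> D\<^sub>1 \<Longrightarrow> v \<notin> B\<^sub>1 \<Longrightarrow> u \<in> D\<^sub>1"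
    and closed2: "(u, v) \<in> W \<Longrightarrow> v \<noteq> r \<Longrightarrow> v \<in> D\<^sub>2 \<Longrightarrow> v \<notin> B\<^sub>2 \<Longrightarrow> u \<in> D\<^sub>2"
begin

text \<open>The condition on AND-gates survives shrinking both sets. An OR-gate outside the bag
  keeps its chosen input because all its inputs are on its side.\<close>

lemma valid_restrict:
  assumes "valid lb V W B\<^sub>1 X (D\<^sub>1 \<union> D\<^sub>2 - X)"
  shows "valid lb V W B\<^sub>1 (X \<inter> D\<^sub>1) (D\<^sub>1 - X)" and "valid lb V W B\<^sub>2 (X \<inter> D\<^sub>2) (D\<^sub>2 - X)"
proof -
  have *: "v \<noteq> r" if "lb v = Or" for v using that lb_r by auto
  show "valid lb V W B\<^sub>1 (X \<inter> D\<^sub>1) (D\<^sub>1 - X)"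
    unfolding valid_def
  proof (intro ballI impI conjI)
    fix v assume v: "v \<in> V" "v \<in> X \<inter> D\<^sub>1"
    show "\<not> fed W v (D\<^sub>1 - X)" if "lb v = And"
      using assms v that by (auto simp: valid_def fed_def)
    show "v \<in> B\<^sub>1 \<or> fed W v (X \<inter> D\<^sub>1)" if Or: "lb v = Or"
    proof (cases "v \<in> B\<^sub>1")
      case False
      then obtain u where u: "(u, v) \<in> W" "u \<in> X"
        using assms v Or unfolding valid_def fed_def by blast
      have "u \<in> D\<^sub>1" using closed1[OF u(1) *[OF Or]] v False by simp
      then show ?thesis using u by (auto simp: fed_def)
    qed simp
  qed
  show "valid lb V W B\<^sub>2 (X \<inter> D\<^sub>2) (D\<^sub>2 - X)"
    unfolding valid_def
  proof (intro ballI impI conjI)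
    fix v assume v: "v \<in> V" "v \<in> X \<inter> D\<^sub>2"
    show "\<not> fed W v (D\<^sub>2 - X)" if "lb v = And"
      using assms v that by (auto simp: valid_def fed_def)
    show "v \<in> B\<^sub>2 \<or> fed W v (X \<inter> D\<^sub>2)" if Or: "lb v = Or"
    proof (cases "v \<in> B\<^sub>2")
      case False
      \<comment> \<open>A vertex of both sides is in both bags. So \<open>v\<close> is outside
        \<open>B\<^sub>1\<close> too, where \<open>X\<close> must already feed it.\<close>
      then have "v \<notin> B\<^sub>1" using sep[of v] B1 v *[OF Or] by auto
      then obtain u where u: "(u, v) \<in> W" "u \<in> X"
        using assms v Or unfolding valid_def fed_def by blast
      have "u \<in> D\<^sub>2" using closed2[OF u(1) *[OF Or]] v False by simp
      then show ?thesis using u by (auto simp: fed_def)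
    qed simp
  qed
qed

section \<open>Replacing the two restrictions of a solution by equivalent entries\<close>

context
  fixes X S\<^sub>1 Z\<^sub>1 S\<^sub>2 Z\<^sub>2
  assumes X: "valid lb V W B\<^sub>1 X (D\<^sub>1 \<union> D\<^sub>2 - X)" "X \<subseteq> D\<^sub>1 \<union> D\<^sub>2" "r \<in> X"
    and e1: "valid lb V W B\<^sub>1 S\<^sub>1 Z\<^sub>1" "S\<^sub>1 \<union> Z\<^sub>1 = D\<^sub>1" "r \<in> S\<^sub>1" "agree W B\<^sub>1 S\<^sub>1 Z\<^sub>1 (X \<inter> D\<^sub>1) (D\<^sub>1 - X)"
    and e2: "valid lb V W B\<^sub>2 S\<^sub>2 Z\<^sub>2" "S\<^sub>2 \<union> Z\<^sub>2 = D\<^sub>2" "r \<in> S\<^sub>2" "agree W B\<^sub>2 S\<^sub>2 Z\<^sub>2 (X \<inter> D\<^sub>2) (D\<^sub>2 - X)"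
begin

lemma mem1: "v \<in> B\<^sub>1 \<Longrightarrow> (v \<in> S\<^sub>1 \<longleftrightarrow> v \<in> X) \<and> (v \<in> Z\<^sub>1 \<longleftrightarrow> v \<notin> X)"
  using e1(4) B1 by (auto simp: agree_def)

lemma mem2: "v \<in> B\<^sub>2 \<Longrightarrow> (v \<in> S\<^sub>2 \<longleftrightarrow> v \<in> X) \<and> (v \<in> Z\<^sub>2 \<longleftrightarrow> v \<notin> X)"
  using e2(4) B2 by (auto simp: agree_def)

lemma sub: "S\<^sub>1 \<subseteq> D\<^sub>1" "Z\<^sub>1 \<subseteq> D\<^sub>1" "S\<^sub>2 \<subseteq> D\<^sub>2" "Z\<^sub>2 \<subseteq> D\<^sub>2"
  using e1(2) e2(2) by auto

lemma fed1: "v \<in> B\<^sub>1 \<Longrightarrow> fed W v S\<^sub>1 \<longleftrightarrow> fed W v (X \<inter> D\<^sub>1)"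
  using e1(4) by (simp add: agree_def)

lemma fed2: "v \<in> B\<^sub>2 \<Longrightarrow> fed W v S\<^sub>2 \<longleftrightarrow> fed W v (X \<inter> D\<^sub>2)"
  using e2(4) by (simp add: agree_def)

text \<open>A conflict between the sides would lie on a wire one of whose ends is in both bags.
  There both entries make the same choice as \<open>X\<close>, so the conflict would already occur
  within one side.\<close>

lemma valid_join: "valid lb V W B\<^sub>1 (S\<^sub>1 \<union> S\<^sub>2) (Z\<^sub>1 \<union> Z\<^sub>2)"
  unfolding valid_def
proof (intro ballI impI conjI)
  fix v assume v: "v \<in> V" "v \<in> S\<^sub>1 \<union> S\<^sub>2"
  {
    assume "lb v = And"
    then have no: "v \<in> S\<^sub>1 \<Longrightarrow> (u, v) \<in> W \<Longrightarrow> u \<notin> Z\<^sub>1" "v \<in> S\<^sub>2 \<Longrightarrow> (u, v) \<in> W \<Longrightarrow> u \<notin> Z\<^sub>2" for u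
      using v(1) e1(1) e2(1) by (auto simp: valid_def fed_def)
    show "\<not> fed W v (Z\<^sub>1 \<union> Z\<^sub>2)"
    proof
      assume "fed W v (Z\<^sub>1 \<union> Z\<^sub>2)"
      then obtain u where u: "(u, v) \<in> W" "u \<in> Z\<^sub>1 \<union> Z\<^sub>2" by (auto simp: fed_def)
      show False
      proof (cases "v = r")
        case True
        \<comment> \<open>The output is chosen on both sides, so the side that rejects
          \<open>u\<close> is invalid by itself.\<close>
        then show False using no u e1(3) e2(3) by blast
      next
        case False
        have "u \<in> B\<^sub>1 \<and> u \<in> B\<^sub>2 \<or> v \<in> B\<^sub>1 \<and> v \<in> B\<^sub>2"
          using cross[OF u(1) False] no u v sub by blast
        then show False
          using mem1 mem2 no u v by blast
      qed
    qed
  }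
  assume Or: "lb v = Or"
  then have "v \<noteq> r" using lb_r by auto
  show "v \<in> B\<^sub>1 \<or> fed W v (S\<^sub>1 \<union> S\<^sub>2)"
  proof (rule disjCI)
    assume nf: "\<not> fed W v (S\<^sub>1 \<union> S\<^sub>2)"
    show "v \<in> B\<^sub>1"
    proof (rule ccontr)
      assume nB: "v \<notin> B\<^sub>1"
      have "v \<notin> S\<^sub>1" using nf nB v Or e1(1) by (auto simp: valid_def fed_def)
      then have "v \<in> S\<^sub>2" using v by simp
      then have "v \<in> B\<^sub>2" using nf v Or e2(1) by (auto simp: valid_def fed_def)
      then have "v \<in> X" using mem2 \<open>v \<in> S\<^sub>2\<close> by blast
      then obtain u where u: "(u, v) \<in> W" "u \<in> X"
        using X(1) v(1) Or nB by (auto simp: valid_def fed_def)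
      \<comment> \<open>If \<open>u\<close> were on the first side only, \<open>cross\<close> would
        put \<open>u\<close> into \<open>B\<^sub>2\<close> or \<open>v\<close> into
        \<open>B\<^sub>1\<close>, and both are excluded. So the input that \<open>X\<close> provides
        is recorded in the signature of the second entry.\<close>
      have "u \<in> D\<^sub>2"
        using cross[OF u(1) \<open>v \<noteq> r\<close>] u(2) X(2) nB \<open>v \<in> B\<^sub>2\<close> B2 by blast
      then have "fed W v S\<^sub>2" using u fed2[OF \<open>v \<in> B\<^sub>2\<close>] by (auto simp: fed_def)
      then show False using nf by (auto simp: fed_def)
    qed
  qed
qed

text \<open>Only the \<open>fed\<close> bit can be influenced from the other side. If the gate is in
  both bags, the other signature records that bit; otherwise the feeding vertex is in both bags and
  is chosen exactly if \<open>X\<close> chooses it.\<close>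

lemma agree_join: "agree W B\<^sub>1 (S\<^sub>1 \<union> S\<^sub>2) (Z\<^sub>1 \<union> Z\<^sub>2) X (D\<^sub>1 \<union> D\<^sub>2 - X)"
  unfolding agree_def
proof (intro ballI conjI)
  fix v assume v: "v \<in> B\<^sub>1"
  then have vr: "v \<noteq> r" "v \<in> D\<^sub>1" using r B1 by auto
  have v2: "v \<in> D\<^sub>2 \<Longrightarrow> v \<in> B\<^sub>2" using sep vr by blast
  show "v \<in> S\<^sub>1 \<union> S\<^sub>2 \<longleftrightarrow> v \<in> X" using mem1[OF v] mem2 v2 sub by blast
  show "v \<in> Z\<^sub>1 \<union> Z\<^sub>2 \<longleftrightarrow> v \<in> D\<^sub>1 \<union> D\<^sub>2 - X" using mem1[OF v] mem2 v2 sub vr by blast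
  show "fed W v (S\<^sub>1 \<union> S\<^sub>2) \<longleftrightarrow> fed W v X"
  proof
    assume "fed W v (S\<^sub>1 \<union> S\<^sub>2)"
    then consider "fed W v S\<^sub>1" | u where "(u, v) \<in> W" "u \<in> S\<^sub>2" by (auto simp: fed_def)
    then show "fed W v X"
    proof cases
      case 1
      then show ?thesis using fed1[OF v] by (auto simp: fed_def)
    next
      case 2
      show ?thesis
      proof (cases "v \<in> B\<^sub>2")
        case True
        have "fed W v S\<^sub>2" using 2 by (auto simp: fed_def)
        then show ?thesis using fed2[OF True] by (auto simp: fed_def)
      next
        case False
        then have "u \<in> B\<^sub>2" using cross[OF 2(1) vr(1)] 2 vr sub by blast
        then show ?thesis using mem2 2 by (auto simp: fed_def)
      qed
    qed
  next
    assume "fed W v X"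
    then obtain u where u: "(u, v) \<in> W" "u \<in> X" by (auto simp: fed_def)
    have "fed W v S\<^sub>1 \<or> fed W v S\<^sub>2"
    proof (cases "u \<in> D\<^sub>1")
      case True
      then show ?thesis using fed1[OF v] u by (auto simp: fed_def)
    next
      case False
      then have u2: "u \<in> D\<^sub>2" using u X(2) by blast
      then have "v \<in> B\<^sub>2" using cross[OF u(1) vr(1)] vr False B1 by blast
      then show ?thesis using fed2 u u2 by (auto simp: fed_def)
    qed
    then show "fed W v (S\<^sub>1 \<union> S\<^sub>2)" by (auto simp: fed_def)
  qed
qed

text \<open>Inclusion and exclusion: the chosen literals common to both sides lie in both bags,
  hence are those of \<open>X\<close>, and the sums on the two sides are compared termwise. The
  output, also shared, is no literal.\<close>

lemma lit_count_join:
  assumes "lit_count lb V S\<^sub>1 \<le> lit_count lb V (X \<inter> D\<^sub>1)" "lit_count lb V S\<^sub>2 \<le> lit_count lb V (X \<inter> D\<^sub>2)"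
  shows "lit_count lb V (S\<^sub>1 \<union> S\<^sub>2) \<le> lit_count lb V X"
proof -
  let ?L = "\<lambda>S. {v \<in> V. is_lit (lb v) \<and> v \<in> S}"
  have fin: "finite (?L S)" for S using finite_V by simp
  have un: "card (?L S) + card (?L T) = card (?L (S \<union> T)) + card (?L (S \<inter> T))" for S T
  proof -
    have "?L (S \<union> T) = ?L S \<union> ?L T" "?L (S \<inter> T) = ?L S \<inter> ?L T" by auto
    then show ?thesis using card_Un_Int[OF fin fin] by simp
  qed
  have "?L (S\<^sub>1 \<inter> S\<^sub>2) = ?L ((X \<inter> D\<^sub>1) \<inter> (X \<inter> D\<^sub>2))"
  proof (intro Collect_cong conj_cong refl)
    fix v assume "is_lit (lb v)"
    then have "v \<noteq> r" using lb_r by auto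
    then show "v \<in> S\<^sub>1 \<inter> S\<^sub>2 \<longleftrightarrow> v \<in> (X \<inter> D\<^sub>1) \<inter> (X \<inter> D\<^sub>2)"
      using sep mem1 mem2 sub by blast
  qed
  moreover have "(X \<inter> D\<^sub>1) \<union> (X \<inter> D\<^sub>2) = X" using X(2) by auto
  ultimately show ?thesis
    using un[of S\<^sub>1 S\<^sub>2] un[of "X \<inter> D\<^sub>1" "X \<inter> D\<^sub>2"] assms unfolding lit_count_def by simp
qed

end

end

section \<open>Tables of parts: leaves and joins\<close>

context gates
begin

text \<open>A table for a part \<open>D\<close> of the circuit that meets the rest of it only in \<open>B\<close>. Completeness is
  up to the signature, as this is all that the rest of the circuit can observe.\<close>

definition table_for :: "nat set \<Rightarrow> nat list \<Rightarrow> entry list \<Rightarrow> bool" where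
  "table_for D B L \<longleftrightarrow>
     (\<forall>e\<in>set L. set (fst e) \<union> set (snd e) = D \<and> r \<in> set (fst e) \<and>
        valid lb V W (set B) (set (fst e)) (set (snd e))) \<and>
     (\<forall>X. r \<in> X \<and> X \<subseteq> D \<and> valid lb V W (set B) X (D - X) \<longrightarrow>
        (\<exists>e\<in>set L. agree W (set B) (set (fst e)) (set (snd e)) X (D - X) \<and>
           lit_count lb V (set (fst e)) \<le> lit_count lb V X))"

text \<open>Agreement and weight comparison are transitive, so completeness up to signature survives
  keeping one lightest entry. Leaves and joins then only have to exhibit one valid unreduced entry
  for each solution.\<close>

lemma table_for_reduce:
  assumes vs: "distinct vs" "set vs = V"
    and dom: "\<forall>e\<in>set L. set (fst e) \<union> set (snd e) = D \<and> r \<in> set (fst e)"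
    and complete: "\<And>X. r \<in> X \<Longrightarrow> X \<subseteq> D \<Longrightarrow> valid lb V W (set B) X (D - X) \<Longrightarrow>
      \<exists>e\<in>set L. valid lb V W (set B) (set (fst e)) (set (snd e)) \<and>
        agree W (set B) (set (fst e)) (set (snd e)) X (D - X) \<and>
        lit_count lb V (set (fst e)) \<le> lit_count lb V X"
  shows "table_for D B (reduce lb vs W B L)"
  unfolding table_for_def
proof (intro conjI allI impI)
  show "\<forall>e\<in>set (reduce lb vs W B L). set (fst e) \<union> set (snd e) = D \<and> r \<in> set (fst e) \<and>
        valid lb V W (set B) (set (fst e)) (set (snd e))"
    using set_reduce[of lb vs W B L] dom vs by blast
next
  fix X assume "r \<in> X \<and> X \<subseteq> D \<and> valid lb V W (set B) X (D - X)"
  then obtain e where e: "e \<in> set L" "valid lb V W (set B) (set (fst e)) (set (snd e))"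
    "agree W (set B) (set (fst e)) (set (snd e)) X (D - X)"
    "lit_count lb V (set (fst e)) \<le> lit_count lb V X"
    using complete by blast
  then obtain e' where "e' \<in> set (reduce lb vs W B L)" "sig W B e' = sig W B e"
    "entry_weight lb vs e' \<le> entry_weight lb vs e"
    using best_by_dominates[of e "filter (\<lambda>e. valid lb (set vs) W (set B) (set (fst e)) (set (snd e))) L"
        "sig W B" "entry_weight lb vs"] vs unfolding reduce_def by auto
  then show "\<exists>e\<in>set (reduce lb vs W B L). agree W (set B) (set (fst e)) (set (snd e)) X (D - X) \<and>
           lit_count lb V (set (fst e)) \<le> lit_count lb V X"
    using e vs by (auto simp: sig_eq_iff entry_weight_def length_lits intro: agree_trans order_trans)
qed

lemma set_joins: "set (joins L L') = (\<Union>e\<in>set L. join e ` set L')"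
  by (auto simp: joins_def)

lemma cands_domain:
  "e \<in> set (cands r vs) \<Longrightarrow> set (fst e) \<union> set (snd e) = insert r (set vs) \<and> r \<in> set (fst e)"
proof (induction vs arbitrary: e)
  case (Cons v vs)
  from Cons.prems obtain e' where e': "e' \<in> set (cands r vs)" and e: "e = join ([v], []) e' \<or> e = join ([], [v]) e'"
    by (auto simp: set_joins)
  have "set (fst e) \<union> set (snd e) = insert v (set (fst e') \<union> set (snd e'))" "set (fst e') \<subseteq> set (fst e)"
    using e by (auto simp: join_def)
  then show ?case using Cons.IH[OF e'] by (simp add: insert_commute subsetD)
qed simp

lemma cands_complete:
  "r \<notin> set vs \<Longrightarrow> distinct vs \<Longrightarrow> r \<in> X \<Longrightarrow> X \<subseteq> insert r (set vs) \<Longrightarrow>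
    \<exists>e\<in>set (cands r vs). set (fst e) = X \<and> set (snd e) = insert r (set vs) - X"
proof (induction vs arbitrary: X)
  case Nil
  then show ?case by auto
next
  case (Cons v vs)
  then obtain e where e: "e \<in> set (cands r vs)" "set (fst e) = X - {v}"
    "set (snd e) = insert r (set vs) - (X - {v})"
  proof -
    have "\<exists>e\<in>set (cands r vs). set (fst e) = X - {v} \<and> set (snd e) = insert r (set vs) - (X - {v})"
      using Cons.prems by (intro Cons.IH) auto
    then show ?thesis using that by blast
  qed
  show ?case
  proof (cases "v \<in> X")
    case True
    have "join ([v], []) e \<in> set (cands r (v # vs))" using e(1) by (simp add: set_joins)
    moreover have "set (fst (join ([v], []) e)) = X" "set (snd (join ([v], []) e)) = insert r (set (v # vs)) - X"
      using e(2,3) True Cons.prems by (auto simp: join_def)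
    ultimately show ?thesis by blast
  next
    case False
    have "join ([], [v]) e \<in> set (cands r (v # vs))" using e(1) by (simp add: set_joins)
    moreover have "set (fst (join ([], [v]) e)) = X" "set (snd (join ([], [v]) e)) = insert r (set (v # vs)) - X"
      using e(2,3) False Cons.prems by (auto simp: join_def)
    ultimately show ?thesis by blast
  qed
qed

lemma table_for_cands:
  assumes "distinct vs" "set vs = V" "r \<notin> set B" "distinct B"
  shows "table_for (insert r (set B)) B (reduce lb vs W B (cands r B))"
proof (rule table_for_reduce[OF assms(1,2)])
  show "\<forall>e\<in>set (cands r B). set (fst e) \<union> set (snd e) = insert r (set B) \<and> r \<in> set (fst e)"
    using cands_domain by blast
next
  fix X assume "r \<in> X" "X \<subseteq> insert r (set B)" and v: "valid lb V W (set B) X (insert r (set B) - X)"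
  then obtain e where "e \<in> set (cands r B)" "set (fst e) = X" "set (snd e) = insert r (set B) - X"
    using cands_complete[OF assms(3,4)] by blast
  then show "\<exists>e\<in>set (cands r B). valid lb V W (set B) (set (fst e)) (set (snd e)) \<and>
        agree W (set B) (set (fst e)) (set (snd e)) X (insert r (set B) - X) \<and>
        lit_count lb V (set (fst e)) \<le> lit_count lb V X"
    using v by (intro bexI[of _ e]) (auto simp: agree_def)
qed

text \<open>A solution \<open>X\<close> is cut into its two restrictions, completeness of each table
  supplies a substitute, and the join of the substitutes agrees with \<open>X\<close> and is no
  heavier.\<close>

lemma table_for_joins:
  assumes "distinct vs" "set vs = V"
    and sep: "separation lb V W r D\<^sub>1 D\<^sub>2 (set B\<^sub>1) (set B\<^sub>2)"
    and L1: "table_for D\<^sub>1 B\<^sub>1 L\<^sub>1" and L2: "table_for D\<^sub>2 B\<^sub>2 L\<^sub>2"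
  shows "table_for (D\<^sub>1 \<union> D\<^sub>2) B\<^sub>1 (reduce lb vs W B\<^sub>1 (joins L\<^sub>1 L\<^sub>2))"
proof (rule table_for_reduce[OF assms(1,2)])
  show "\<forall>e\<in>set (joins L\<^sub>1 L\<^sub>2). set (fst e) \<union> set (snd e) = D\<^sub>1 \<union> D\<^sub>2 \<and> r \<in> set (fst e)"
    using L1 L2 by (fastforce simp: set_joins join_def table_for_def)
next
  interpret separation lb V W r D\<^sub>1 D\<^sub>2 "set B\<^sub>1" "set B\<^sub>2" by (rule sep)
  fix X assume X: "r \<in> X" "X \<subseteq> D\<^sub>1 \<union> D\<^sub>2" "valid lb V W (set B\<^sub>1) X (D\<^sub>1 \<union> D\<^sub>2 - X)"
  have d: "D\<^sub>1 - X \<inter> D\<^sub>1 = D\<^sub>1 - X" "D\<^sub>2 - X \<inter> D\<^sub>2 = D\<^sub>2 - X" by auto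
  obtain e1 where e1: "e1 \<in> set L\<^sub>1" "agree W (set B\<^sub>1) (set (fst e1)) (set (snd e1)) (X \<inter> D\<^sub>1) (D\<^sub>1 - X)"
    "lit_count lb V (set (fst e1)) \<le> lit_count lb V (X \<inter> D\<^sub>1)"
    using L1 valid_restrict(1)[OF X(3)] X(1) r(1) unfolding table_for_def
    by (auto dest!: spec[of _ "X \<inter> D\<^sub>1"] simp: d)
  obtain e2 where e2: "e2 \<in> set L\<^sub>2" "agree W (set B\<^sub>2) (set (fst e2)) (set (snd e2)) (X \<inter> D\<^sub>2) (D\<^sub>2 - X)"
    "lit_count lb V (set (fst e2)) \<le> lit_count lb V (X \<inter> D\<^sub>2)"
    using L2 valid_restrict(2)[OF X(3)] X(1) r(2) unfolding table_for_def
    by (auto dest!: spec[of _ "X \<inter> D\<^sub>2"] simp: d)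
  have t1: "valid lb V W (set B\<^sub>1) (set (fst e1)) (set (snd e1))" "set (fst e1) \<union> set (snd e1) = D\<^sub>1"
    "r \<in> set (fst e1)"
    using L1 e1(1) by (auto simp: table_for_def)
  have t2: "valid lb V W (set B\<^sub>2) (set (fst e2)) (set (snd e2))" "set (fst e2) \<union> set (snd e2) = D\<^sub>2"
    "r \<in> set (fst e2)"
    using L2 e2(1) by (auto simp: table_for_def)
  note j = X(3,2,1) t1 e1(2) t2 e2(2)
  have "join e1 e2 \<in> set (joins L\<^sub>1 L\<^sub>2)" using e1 e2 by (auto simp: set_joins)
  then show "\<exists>e\<in>set (joins L\<^sub>1 L\<^sub>2). valid lb V W (set B\<^sub>1) (set (fst e)) (set (snd e)) \<and>
        agree W (set B\<^sub>1) (set (fst e)) (set (snd e)) X (D\<^sub>1 \<union> D\<^sub>2 - X) \<and>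
        lit_count lb V (set (fst e)) \<le> lit_count lb V X"
    using valid_join[OF j] agree_join[OF j] lit_count_join[OF j e1(3) e2(3)]
    by (intro bexI[of _ "join e1 e2"]) (auto simp: join_def)
qed

end

section \<open>Trees and tree decompositions\<close>

definition adj :: "nat set set \<Rightarrow> (nat \<times> nat) set" where
  "adj F = {(a, b). {a, b} \<in> F}"

definition component :: "nat set set \<Rightarrow> nat \<Rightarrow> nat set" where
  "component F i = {j. (i, j) \<in> (adj F)\<^sup>*}"

lemma sym_adj: "sym (adj F)"
  by (auto simp: sym_def adj_def insert_commute)

lemma adj_rtrancl_sym: "(a, b) \<in> (adj F)\<^sup>* \<Longrightarrow> (b, a) \<in> (adj F)\<^sup>*"
  using sym_rtrancl[OF sym_adj] by (auto dest: symD)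

lemma component_mono: "F \<subseteq> F' \<Longrightarrow> component F i \<subseteq> component F' i"
  unfolding component_def using rtrancl_mono[of "adj F" "adj F'"] by (auto simp: adj_def)

lemma component_refl [simp]: "i \<in> component F i"
  by (simp add: component_def)

lemma component_isolated: "(\<And>e. e \<in> F \<Longrightarrow> i \<notin> e) \<Longrightarrow> component F i = {i}"
  by (auto simp: component_def adj_def elim: converse_rtranclE)

lemma component_insert: "component (insert {i, k} F) i = component F i \<union> component F k"
proof
  have "j \<in> component F i \<union> component F k" if "(i, j) \<in> (adj (insert {i, k} F))\<^sup>*" for j
    using that
  proof induction
    case (step x y)
    then have "{x, y} = {i, k} \<or> (x, y) \<in> adj F" by (auto simp: adj_def)
    then show ?case
      using step.IH by (auto simp: component_def doubleton_eq_iff intro: rtrancl_into_rtrancl)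
  qed simp
  then show "component (insert {i, k} F) i \<subseteq> component F i \<union> component F k" by (auto simp: component_def)
next
  have "(i, k) \<in> adj (insert {i, k} F)" by (simp add: adj_def)
  moreover have "(adj F)\<^sup>* \<subseteq> (adj (insert {i, k} F))\<^sup>*" by (rule rtrancl_mono) (auto simp: adj_def)
  ultimately show "component F i \<union> component F k \<subseteq> component (insert {i, k} F) i"
    by (auto simp: component_def intro: converse_rtrancl_into_rtrancl)
qed

section \<open>Simple paths and bridges\<close>

lemma distinct_path:
  assumes "(a, b) \<in> R\<^sup>*"
  shows "\<exists>p. p \<noteq> [] \<and> hd p = a \<and> last p = b \<and> distinct p \<and> successively (\<lambda>x y. (x, y) \<in> R) p"
  using assms
proof (induction rule: converse_rtrancl_induct)
  case base
  show ?case by (intro exI[of _ "[b]"]) simp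
next
  case (step a a')
  then obtain p where p: "p \<noteq> []" "hd p = a'" "last p = b" "distinct p"
    "successively (\<lambda>x y. (x, y) \<in> R) p" by blast
  show ?case
  proof (cases "a \<in> set p")
    case True
    then obtain ys zs where "p = ys @ a # zs" by (auto simp: in_set_conv_decomp)
    then show ?thesis
      using p by (intro exI[of _ "a # zs"]) (auto simp: successively_append_iff)
  next
    case False
    then show ?thesis
      using p step by (intro exI[of _ "a # p"]) (auto simp: successively_Cons)
  qed
qed

text \<open>A simple path between the ends that avoids the edge would close up with it to a cycle.
  It has at least three vertices since the ends differ and the edge itself is gone.\<close>

lemma acyclic_bridge:
  assumes nc: "\<nexists>p. cycle F p" and e: "{i, k} \<in> F" "i \<noteq> k"
  shows "(i, k) \<notin> (adj (F - {{i, k}}))\<^sup>*"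
proof
  assume "(i, k) \<in> (adj (F - {{i, k}}))\<^sup>*"
  from distinct_path[OF this] obtain p where p: "p \<noteq> []" "hd p = i" "last p = k" "distinct p"
    and suc: "successively (\<lambda>x y. (x, y) \<in> adj (F - {{i, k}})) p"
    by blast
  have s: "{p ! n, p ! Suc n} \<in> F - {{i, k}}" if "Suc n < length p" for n
    using that suc by (simp add: successively_conv_nth adj_def)
  have hd: "p ! 0 = i" and last: "p ! (length p - 1) = k"
    using p by (simp_all add: hd_conv_nth last_conv_nth)
  have "length p \<noteq> 1" using hd last e(2) by auto
  moreover have "length p \<noteq> 2" using s[of 0] hd last by auto
  ultimately have len: "3 \<le> length p" using p(1)
    by (metis One_nat_def Suc_1 length_0_conv less_2_cases not_less_eq_eq numeral_3_eq_3 not_le antisym_conv3)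
  have "{p ! n, p ! (Suc n mod length p)} \<in> F" if "n < length p" for n
  proof (cases "Suc n < length p")
    case True
    then show ?thesis using s by auto
  next
    case False
    then have "Suc n = length p" using that by simp
    then have n: "n = length p - 1" and "Suc n mod length p = 0" by auto
    then show ?thesis using n hd last e(1) by (simp add: insert_commute)
  qed
  then have "cycle F p" using len p(4) by (simp add: cycle_def)
  then show False using nc by blast
qed

section \<open>Trees in which each vertex occupies a connected set of bags\<close>

locale tree_bags =
  fixes F :: "nat set set" and I :: "nat set" and bg :: "nat \<Rightarrow> nat set"
  assumes finite_I: "finite I" and edge_nodes: "{i, k} \<in> F \<Longrightarrow> i \<in> I \<and> k \<in> I \<and> i \<noteq> k"
    and connected: "i \<in> I \<Longrightarrow> j \<in> I \<Longrightarrow> (i, j) \<in> (adj F)\<^sup>*"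
    and acyclic: "\<nexists>p. cycle F p"
    and bag_connected: "a \<in> I \<Longrightarrow> b \<in> I \<Longrightarrow> v \<in> bg a \<Longrightarrow> v \<in> bg b \<Longrightarrow>
      (a, b) \<in> {(a, b). v \<in> bg a \<and> v \<in> bg b \<and> {a, b} \<in> F}\<^sup>*"
begin

lemma component_nodes: "E \<subseteq> F \<Longrightarrow> i \<in> I \<Longrightarrow> component E i \<subseteq> I"
proof
  fix j assume E: "E \<subseteq> F" and i: "i \<in> I" and "j \<in> component E i"
  then have "(i, j) \<in> (adj E)\<^sup>*" by (simp add: component_def)
  then show "j \<in> I" using i
    by (induction rule: rtrancl_induct) (use E edge_nodes in \<open>auto simp: adj_def\<close>)
qed

lemma component_all: "i \<in> I \<Longrightarrow> component F i = I"
  using component_nodes[of F i] connected by (auto simp: component_def)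

lemma sides_disjoint: "{i, k} \<in> F \<Longrightarrow> component (F - {{i, k}}) i \<inter> component (F - {{i, k}}) k = {}"
  using acyclic_bridge[OF acyclic] edge_nodes
  by (auto simp: component_def dest: adj_rtrancl_sym rtrancl_trans)

text \<open>The nodes whose bags contain \<open>v\<close> are connected. If one end of the edge were
  not among them, a path between \<open>a\<close> and \<open>b\<close> would avoid the edge,
  although it is a bridge.\<close>

lemma shared_vertex:
  assumes e: "{i, k} \<in> F" and a: "a \<in> component (F - {{i, k}}) i" "v \<in> bg a"
    and b: "b \<in> component (F - {{i, k}}) k" "v \<in> bg b"
  shows "v \<in> bg i \<and> v \<in> bg k"
proof (rule ccontr)
  assume no: "\<not> (v \<in> bg i \<and> v \<in> bg k)"
  have "a \<in> I" "b \<in> I" using a b component_nodes[of "F - {{i, k}}"] edge_nodes[OF e] by auto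
  then have "(a, b) \<in> {(a, b). v \<in> bg a \<and> v \<in> bg b \<and> {a, b} \<in> F}\<^sup>*"
    using bag_connected a b by blast
  moreover have "{(a, b). v \<in> bg a \<and> v \<in> bg b \<and> {a, b} \<in> F} \<subseteq> adj (F - {{i, k}})"
    using no by (auto simp: adj_def doubleton_eq_iff)
  ultimately have "(a, b) \<in> (adj (F - {{i, k}}))\<^sup>*" using rtrancl_mono by blast
  then have "b \<in> component (F - {{i, k}}) i" using a by (auto simp: component_def)
  then show False using b sides_disjoint[OF e] by blast
qed

lemma node_side: "{i, k} \<in> F \<Longrightarrow> j \<in> I \<Longrightarrow> j \<in> component (F - {{i, k}}) i \<or> j \<in> component (F - {{i, k}}) k"
  using component_all[of i] component_insert[of i k "F - {{i, k}}"] edge_nodes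
  by (metis Un_iff insert_Diff)

text \<open>The node \<open>j\<close> with both vertices lies on one of the sides, so the vertex
  from the other side occurs on both.\<close>

lemma crossing_edge:
  assumes e: "{i, k} \<in> F" and "a \<in> component (F - {{i, k}}) i" "u \<in> bg a"
    and "b \<in> component (F - {{i, k}}) k" "v \<in> bg b" and "j \<in> I" "u \<in> bg j" "v \<in> bg j"
  shows "u \<in> bg i \<and> u \<in> bg k \<or> v \<in> bg i \<and> v \<in> bg k"
  using node_side[OF e] shared_vertex[OF e] assms by blast

text \<open>The component of \<open>i\<close> in a subforest \<open>E\<close> touches the rest of the tree only at \<open>i\<close> itself.\<close>

definition guarded :: "nat set set \<Rightarrow> nat \<Rightarrow> bool" where
  "guarded E i \<longleftrightarrow>
     (\<forall>a\<in>component E i. \<forall>v\<in>bg a. v \<notin> bg i \<longrightarrow> (\<forall>j\<in>I. v \<in> bg j \<longrightarrow> j \<in> component E i))"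

lemma guarded_all: "i \<in> I \<Longrightarrow> guarded F i"
  by (simp add: guarded_def component_all)

text \<open>A vertex seen on both sides of the deleted edge lies in the bags of both ends. So a
  vertex missing from the bag of its own end does not leave its side.\<close>

lemma guarded_split:
  assumes e: "{i, k} \<in> E" and E: "E \<subseteq> F" and g: "guarded E i"
  shows "guarded (E - {{i, k}}) i" "guarded (E - {{i, k}}) k"
proof -
  let ?E = "E - {{i, k}}"
  have eF: "{i, k} \<in> F" using e E by auto
  have un: "component E i = component ?E i \<union> component ?E k"
    using component_insert[of i k ?E] e by (simp add: insert_absorb)
  have sub: "component ?E x \<subseteq> component (F - {{i, k}}) x" for x
    using E by (intro component_mono) auto
  note shared = shared_vertex[OF eF subsetD[OF sub] _ subsetD[OF sub]]
  show "guarded ?E i"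
    using g shared unfolding guarded_def un by blast
  show "guarded ?E k"
    unfolding guarded_def
  proof (intro ballI impI)
    fix a v j assume v: "a \<in> component ?E k" "v \<in> bg a" "v \<notin> bg k" "j \<in> I" "v \<in> bg j"
    \<comment> \<open>The node \<open>i\<close> is on the other side, so \<open>v\<close> in its bag
      would also be in the bag of \<open>k\<close>.\<close>
    then have "v \<notin> bg i" using shared[of i v a] by auto
    then have "j \<in> component E i" using g v unfolding guarded_def un by blast
    then show "j \<in> component ?E k" using shared[of j v a] v unfolding un by blast
  qed
qed

end

section \<open>Tables of tree components\<close>

lemma length_del: "pick E i = Some k \<Longrightarrow> length (del E i) < length E"
  by (induction E i rule: pick.induct) (auto split: if_splits)

text \<open>Both calls receive all remaining edges instead of those of one component. This is
  harmless: \<open>pick\<close> only follows edges at the current node, so a call never leaves its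
  component, and the list need not be partitioned.\<close>

function tab ::
  "(nat \<Rightarrow> label) \<Rightarrow> nat list \<Rightarrow> (nat \<times> nat) set \<Rightarrow> nat \<Rightarrow> (nat \<Rightarrow> nat list) \<Rightarrow>
   (nat \<times> nat) list \<Rightarrow> nat \<Rightarrow> entry list" where
  "tab lb vs W r bs E i = reduce lb vs W (bs i) (case pick E i of
       None \<Rightarrow> cands r (bs i)
     | Some k \<Rightarrow> joins (tab lb vs W r bs (del E i) i) (tab lb vs W r bs (del E i) k))"
  by pat_completeness auto
termination
  by (relation "measure (\<lambda>(lb, vs, W, r, bs, E, i). length E)") (auto simp: length_del)

declare tab.simps [simp del]

abbreviation edge_sets :: "(nat \<times> nat) list \<Rightarrow> nat set list" where
  "edge_sets \<equiv> map (\<lambda>(i, j). {i, j})"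

lemma pick_None: "pick E i = None \<Longrightarrow> e \<in> set (edge_sets E) \<Longrightarrow> i \<notin> e"
  by (induction E i rule: pick.induct) (auto split: if_splits)

lemma pick_Some:
  "pick E i = Some k \<Longrightarrow> distinct (edge_sets E) \<Longrightarrow>
    {i, k} \<in> set (edge_sets E) \<and> set (edge_sets (del E i)) = set (edge_sets E) - {{i, k}} \<and>
    distinct (edge_sets (del E i))"
proof (induction E i rule: pick.induct)
  case (2 a b E i)
  show ?case
  proof (cases "i = a \<or> i = b")
    case True
    then have "{a, b} = {i, k}" using 2(2) by (auto split: if_splits)
    moreover have "set (edge_sets (del ((a, b) # E) i)) = set (edge_sets E)" using True by auto
    moreover have "{a, b} \<notin> set (edge_sets E)" "distinct (edge_sets E)" using 2(3) by auto
    ultimately show ?thesis using True by auto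
  next
    case False
    then have IH: "{i, k} \<in> set (edge_sets E)"
      "set (edge_sets (del E i)) = set (edge_sets E) - {{i, k}}" "distinct (edge_sets (del E i))"
      using 2 by auto
    moreover have "{a, b} \<noteq> {i, k}" using False by (auto simp: doubleton_eq_iff)
    moreover have "{a, b} \<notin> set (edge_sets E)" using 2(3) by auto
    ultimately show ?thesis using False by (auto simp: insert_Diff_if)
  qed
qed simp

locale decomposed_circuit = gates lb V W r + tree_bags F I "\<lambda>i. set (bs i)"
  for lb :: "nat \<Rightarrow> label" and V W r F I and bs :: "nat \<Rightarrow> nat list" +
  fixes vs :: "nat list"
  assumes vs: "distinct vs" "set vs = V"
    and distinct_bs: "i \<in> I \<Longrightarrow> distinct (bs i)"
    and r_bs: "i \<in> I \<Longrightarrow> r \<notin> set (bs i)"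
    and wire_bag: "(u, v) \<in> W \<Longrightarrow> v \<noteq> r \<Longrightarrow> \<exists>j\<in>I. u \<in> set (bs j) \<and> v \<in> set (bs j)"
    and cover: "V = insert r (\<Union>i\<in>I. set (bs i))"
begin

definition part :: "nat set set \<Rightarrow> nat \<Rightarrow> nat set" where
  "part E i = insert r (\<Union>j\<in>component E i. set (bs j))"

lemma part_split:
  "{i, k} \<in> E \<Longrightarrow> part E i = part (E - {{i, k}}) i \<union> part (E - {{i, k}}) k"
  using component_insert[of i k "E - {{i, k}}"] by (auto simp: part_def insert_absorb)

text \<open>The conditions on shared vertices and on wires between the sides follow from the bridge
  property. Closedness rests on \<open>guarded\<close>: without it, the bag that holds a gate and
  its input could lie outside the component.\<close>

lemma separation_parts:
  assumes e: "{i, k} \<in> E" and E: "E \<subseteq> F" and g: "guarded E i"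
  shows "separation lb V W r (part (E - {{i, k}}) i) (part (E - {{i, k}}) k) (set (bs i)) (set (bs k))"
proof
  let ?E = "E - {{i, k}}"
  have eF: "{i, k} \<in> F" using e E by auto
  have I: "i \<in> I" "k \<in> I" using edge_nodes[OF eF] by auto
  have sub: "component ?E x \<subseteq> component (F - {{i, k}}) x" for x
    using E by (intro component_mono) auto
  show "set (bs i) \<subseteq> part ?E i" "set (bs k) \<subseteq> part ?E k" "r \<in> part ?E i" "r \<in> part ?E k"
    by (auto simp: part_def intro: bexI[OF _ component_refl])
  show "r \<notin> set (bs i)" "r \<notin> set (bs k)" using r_bs I by auto
  show "v \<in> set (bs i) \<and> v \<in> set (bs k)" if v: "v \<in> part ?E i" "v \<in> part ?E k" "v \<noteq> r" for v
  proof -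
    obtain a b where "a \<in> component ?E i" "v \<in> set (bs a)" "b \<in> component ?E k" "v \<in> set (bs b)"
      using v by (auto simp: part_def)
    then show ?thesis using shared_vertex[OF eF subsetD[OF sub] _ subsetD[OF sub]] by blast
  qed
  show "u \<in> set (bs i) \<and> u \<in> set (bs k) \<or> v \<in> set (bs i) \<and> v \<in> set (bs k)"
    if w: "(u, v) \<in> W" "v \<noteq> r" and uv: "u \<in> part ?E i \<and> v \<in> part ?E k \<or> u \<in> part ?E k \<and> v \<in> part ?E i"
    for u v
  proof -
    have "u \<noteq> r" using w r_sink by auto
    obtain j where j: "j \<in> I" "u \<in> set (bs j)" "v \<in> set (bs j)" using wire_bag[OF w] by blast
    show ?thesis
      using uv
    proof
      assume "u \<in> part ?E i \<and> v \<in> part ?E k"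
      then obtain a b where "a \<in> component ?E i" "u \<in> set (bs a)" "b \<in> component ?E k" "v \<in> set (bs b)"
        using w(2) \<open>u \<noteq> r\<close> by (auto simp: part_def)
      then show ?thesis using crossing_edge[OF eF subsetD[OF sub] _ subsetD[OF sub] _ j] by blast
    next
      assume "u \<in> part ?E k \<and> v \<in> part ?E i"
      then obtain a b where "a \<in> component ?E i" "v \<in> set (bs a)" "b \<in> component ?E k" "u \<in> set (bs b)"
        using w(2) \<open>u \<noteq> r\<close> by (auto simp: part_def)
      then show ?thesis using crossing_edge[OF eF subsetD[OF sub] _ subsetD[OF sub] _ j(1,3,2)] by blast
    qed
  qed
  have closed: "u \<in> part ?E x" if v: "guarded ?E x" "(u, v) \<in> W" "v \<noteq> r" "v \<in> part ?E x" "v \<notin> set (bs x)"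
    for x u v
  proof -
    obtain j where j: "j \<in> I" "u \<in> set (bs j)" "v \<in> set (bs j)" using wire_bag v by blast
    obtain a where "a \<in> component ?E x" "v \<in> set (bs a)" using v by (auto simp: part_def)
    then have "j \<in> component ?E x" using v(1,5) j unfolding guarded_def by blast
    then show ?thesis using j by (auto simp: part_def)
  qed
  show "u \<in> part ?E i" if "(u, v) \<in> W" "v \<noteq> r" "v \<in> part ?E i" "v \<notin> set (bs i)" for u v
    using closed[OF guarded_split(1)[OF e E g]] that by blast
  show "u \<in> part ?E k" if "(u, v) \<in> W" "v \<noteq> r" "v \<in> part ?E k" "v \<notin> set (bs k)" for u v
    using closed[OF guarded_split(2)[OF e E g]] that by blast
qed

abbreviation "table \<equiv> tab lb vs W r bs"

lemma table_for_tab: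
  assumes "set (edge_sets E) \<subseteq> F" "distinct (edge_sets E)" "i \<in> I" "guarded (set (edge_sets E)) i"
  shows "table_for (part (set (edge_sets E)) i) (bs i) (table E i)"
  using assms
proof (induction "length E" arbitrary: E i rule: less_induct)
  case less
  show ?case
  proof (cases "pick E i")
    case None
    then have "component (set (edge_sets E)) i = {i}" using pick_None by (intro component_isolated) blast
    then have "part (set (edge_sets E)) i = insert r (set (bs i))" by (simp add: part_def)
    moreover have "table E i = reduce lb vs W (bs i) (cands r (bs i))"
      by (subst tab.simps) (simp add: None)
    ultimately show ?thesis using table_for_cands[OF vs] r_bs distinct_bs less.prems(3) by simp
  next
    case (Some k)
    note p = pick_Some[OF Some less.prems(2)]
    let ?E = "set (edge_sets (del E i))"
    have eq: "?E = set (edge_sets E) - {{i, k}}" using p by blast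
    have e: "{i, k} \<in> set (edge_sets E)" using p by blast
    have k: "k \<in> I" using e less.prems(1) edge_nodes by blast
    have sub: "?E \<subseteq> F" using eq less.prems(1) by blast
    have "table E i = reduce lb vs W (bs i) (joins (table (del E i) i) (table (del E i) k))"
      by (subst tab.simps) (simp add: Some)
    moreover have "table_for (part ?E i) (bs i) (table (del E i) i)"
      using less.hyps[OF length_del[OF Some] sub] p less.prems(3) guarded_split(1)[OF e less.prems(1,4)] eq
      by simp
    moreover have "table_for (part ?E k) (bs k) (table (del E i) k)"
      using less.hyps[OF length_del[OF Some] sub] p k guarded_split(2)[OF e less.prems(1,4)] eq
      by simp
    ultimately show ?thesis
      using table_for_joins[OF vs separation_parts[OF e less.prems(1,4)]] part_split[OF e] eq
      by simp
  qed
qed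

text \<open>The additive quantity to which both the lengths of the entries and the number of calls
  are charged.\<close>

lemma card_component_split:
  assumes e: "{i, k} \<in> E" and E: "E \<subseteq> F"
  shows "card (component E i) = card (component (E - {{i, k}}) i) + card (component (E - {{i, k}}) k)"
proof -
  let ?E = "E - {{i, k}}"
  have eF: "{i, k} \<in> F" using e E by auto
  have sub: "component ?E x \<subseteq> component (F - {{i, k}}) x" for x
    using E by (intro component_mono) auto
  have "component ?E x \<subseteq> I" if "x \<in> I" for x using component_nodes[of ?E x] E that by auto
  then have "finite (component ?E i)" "finite (component ?E k)"
    using edge_nodes[OF eF] finite_I by (auto intro: finite_subset)
  moreover have "component ?E i \<inter> component ?E k = {}" using sub sides_disjoint[OF eF] by blast
  ultimately show ?thesis
    using component_insert[of i k ?E] e by (simp add: insert_absorb card_Un_disjoint)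
qed

lemma length_cands_entry:
  "e \<in> set (cands r B) \<Longrightarrow> length (fst e) \<le> length B + 1 \<and> length (snd e) \<le> length B + 1"
proof (induction B arbitrary: e)
  case (Cons v B)
  from Cons.prems obtain e' where e': "e' \<in> set (cands r B)" and "e = join ([v], []) e' \<or> e = join ([], [v]) e'"
    by (auto simp: set_joins)
  then show ?case using Cons.IH[OF e'] by (auto simp: join_def)
qed simp

text \<open>Joining keeps repetitions, so the number of circuit vertices is no bound. Instead, each
  node of the component contributes at most its bag and one copy of the output.\<close>

lemma length_tab_entry:
  assumes "set (edge_sets E) \<subseteq> F" "distinct (edge_sets E)" "i \<in> I"
    and \<beta>: "\<forall>j\<in>I. length (bs j) \<le> \<beta>" and "e \<in> set (table E i)"
  shows "length (fst e) \<le> card (component (set (edge_sets E)) i) * (\<beta> + 1) \<and>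
         length (snd e) \<le> card (component (set (edge_sets E)) i) * (\<beta> + 1)"
  using assms
proof (induction "length E" arbitrary: E i e rule: less_induct)
  case less
  show ?case
  proof (cases "pick E i")
    case None
    then have "component (set (edge_sets E)) i = {i}" using pick_None by (intro component_isolated) blast
    moreover have "e \<in> set (reduce lb vs W (bs i) (cands r (bs i)))"
      using less.prems(5) by (subst (asm) tab.simps) (simp add: None)
    then have "e \<in> set (cands r (bs i))" using set_reduce by blast
    ultimately show ?thesis using length_cands_entry[of e "bs i"] \<beta> less.prems(3) by fastforce
  next
    case (Some k)
    note p = pick_Some[OF Some less.prems(2)]
    let ?E = "set (edge_sets (del E i))"
    have eq: "?E = set (edge_sets E) - {{i, k}}" using p by blast
    have e: "{i, k} \<in> set (edge_sets E)" using p by blast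
    have k: "k \<in> I" using e less.prems(1) edge_nodes by blast
    have sub: "?E \<subseteq> F" using eq less.prems(1) by blast
    have "e \<in> set (reduce lb vs W (bs i) (joins (table (del E i) i) (table (del E i) k)))"
      using less.prems(5) by (subst (asm) tab.simps) (simp add: Some)
    then have "e \<in> set (joins (table (del E i) i) (table (del E i) k))" using set_reduce by blast
    then obtain e1 e2 where e12: "e1 \<in> set (table (del E i) i)" "e2 \<in> set (table (del E i) k)" "e = join e1 e2"
      by (auto simp: set_joins)
    have "length (fst e1) \<le> card (component ?E i) * (\<beta> + 1) \<and> length (snd e1) \<le> card (component ?E i) * (\<beta> + 1)"
      using less.hyps[OF length_del[OF Some] sub] p less.prems(3) \<beta> e12(1) by blast
    moreover have "length (fst e2) \<le> card (component ?E k) * (\<beta> + 1) \<and> length (snd e2) \<le> card (component ?E k) * (\<beta> + 1)"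
      using less.hyps[OF length_del[OF Some] sub] p k \<beta> e12(2) by blast
    moreover have "card (component (set (edge_sets E)) i) = card (component ?E i) + card (component ?E k)"
      using card_component_split[OF e less.prems(1)] eq by simp
    ultimately show ?thesis by (simp add: e12(3) join_def algebra_simps)
  qed
qed

text \<open>Reducing with the empty bag no longer lets any OR-gate wait. \<open>X\<close> witnesses
  that a valid set exists, so that the result has exactly one entry.\<close>

lemma best_entry:
  assumes E: "set (edge_sets E) = F" "distinct (edge_sets E)" and i: "i \<in> I"
    and X: "r \<in> X" "X \<subseteq> V" "valid lb V W {} X (V - X)"
  obtains S Z where "reduce lb vs W [] (table E i) = [(S, Z)]"
    "r \<in> set S" "set S \<union> set Z = V" "valid lb V W {} (set S) (set Z)"
    "\<forall>Y. r \<in> Y \<and> Y \<subseteq> V \<and> valid lb V W {} Y (V - Y) \<longrightarrow> lit_count lb V (set S) \<le> lit_count lb V Y"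
proof -
  let ?R = "reduce lb vs W [] (table E i)"
  have "part F i = V" using component_all[OF i] cover by (simp add: part_def)
  then have T: "table_for V (bs i) (table E i)"
    using table_for_tab[of E i] E i guarded_all by simp
  have R: "table_for V [] ?R"
  proof (rule table_for_reduce[OF vs])
    show "\<forall>e\<in>set (table E i). set (fst e) \<union> set (snd e) = V \<and> r \<in> set (fst e)"
      using T by (auto simp: table_for_def)
  next
    fix Y assume Y: "r \<in> Y" "Y \<subseteq> V" "valid lb V W (set []) Y (V - Y)"
    then have "valid lb V W (set (bs i)) Y (V - Y)" by (auto simp: valid_def)
    then obtain e where e: "e \<in> set (table E i)" "agree W (set (bs i)) (set (fst e)) (set (snd e)) Y (V - Y)"
        "lit_count lb V (set (fst e)) \<le> lit_count lb V Y"
      using T Y unfolding table_for_def by blast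
    have "valid lb V W (set (bs i)) (set (fst e)) (set (snd e))" using T e(1) by (auto simp: table_for_def)
    \<comment> \<open>A chosen OR-gate in \<open>bs i\<close> is also chosen in \<open>Y\<close>,
      which must feed it, and the \<open>fed\<close> bit carries this over to
      \<open>e\<close>.\<close>
    then have "valid lb V W {} (set (fst e)) (set (snd e))"
      using e(2) Y(3) unfolding valid_def agree_def by auto
    then show "\<exists>e\<in>set (table E i). valid lb V W (set []) (set (fst e)) (set (snd e)) \<and>
        agree W (set []) (set (fst e)) (set (snd e)) Y (V - Y) \<and>
        lit_count lb V (set (fst e)) \<le> lit_count lb V Y"
      using e by (intro bexI[of _ e]) (auto simp: agree_def)
  qed
  have opt: "\<exists>e\<in>set ?R. lit_count lb V (set (fst e)) \<le> lit_count lb V Y"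
    if "r \<in> Y" "Y \<subseteq> V" "valid lb V W {} Y (V - Y)" for Y
    using R that unfolding table_for_def by fastforce
  have "length ?R \<le> 1" using length_reduce_le[of lb vs W "[]"] by simp
  moreover have "?R \<noteq> []" using opt[OF X] by auto
  ultimately obtain e where "?R = [e]" by (cases ?R) auto
  then obtain S Z where SZ: "?R = [(S, Z)]" by (cases e) auto
  show thesis
  proof (rule that[OF SZ])
    show "r \<in> set S" "set S \<union> set Z = V" "valid lb V W {} (set S) (set Z)"
      using R unfolding SZ table_for_def by auto
    show "\<forall>Y. r \<in> Y \<and> Y \<subseteq> V \<and> valid lb V W {} Y (V - Y) \<longrightarrow> lit_count lb V (set S) \<le> lit_count lb V Y"
      using opt unfolding SZ by auto
  qed
qed

end

section \<open>Running time of the whole program\<close>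

text \<open>\<open>U\<close> is, up to a constant, the bound for reducing a product of two tables:
  at most \<open>K * K\<close> entries, a reduced list of at most \<open>K\<close> entries, cubic
  work per comparison. All other costs of a call are measured in \<open>U\<close>.\<close>

lemma time_unit_bounds:
  fixes K m :: nat
  assumes "1 \<le> K" "1 \<le> m"
  defines "U \<equiv> (K * K + 1) * (K + 1) * (m * (m * m))"
  shows "m \<le> U" and "(K + 1) * (K + 1) * m \<le> U" and "m * ((K + 1) * m) \<le> U"
    and "(K * K + 1) * ((K + 1) * (m * (m * m))) = U" and "(K + 1) * (m * (m * m)) \<le> U"
proof -
  have K: "1 \<le> (K * K + 1) * (K + 1)" "(K + 1) * (K + 1) \<le> (K * K + 1) * (K + 1)"
    "K + 1 \<le> (K * K + 1) * (K + 1)"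
    using le_square[of K] by (auto intro: mult_le_mono1)
  have m: "m \<le> m * (m * m)" "m * m \<le> m * (m * m)"
    using assms(2) by auto
  show "m \<le> U" using mult_le_mono[OF K(1) m(1)] by (simp add: U_def)
  show "(K + 1) * (K + 1) * m \<le> U" unfolding U_def by (rule mult_le_mono[OF K(2) m(1)])
  show "m * ((K + 1) * m) \<le> U" using mult_le_mono[OF K(3) m(2)] by (simp add: U_def algebra_simps)
  show "(K * K + 1) * ((K + 1) * (m * (m * m))) = U" unfolding U_def by (simp only: mult.assoc)
  show "(K + 1) * (m * (m * m)) \<le> U" unfolding U_def by (rule mult_le_mono[OF K(3) order_refl])
qed

context decomposed_circuit
begin

context
  fixes ws :: "(nat \<times> nat) list" and ns :: "nat list" and \<beta> m K U :: nat and x :: sexp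
  assumes ws: "set ws = W" and ns: "set ns = I"
    and \<beta>: "\<forall>j\<in>I. length (bs j) \<le> \<beta>"
    and m: "length vs < m" "length ws < m" "length ns < m" "card I * (\<beta> + 1) < m" "\<beta> < m" "2 \<le> m"
    and K: "K = 8 ^ \<beta>" and U: "U = (K * K + 1) * (K + 1) * (m * (m * m))"
    and x: "x = SCons (Sym r) (SCons (enc_verts lb vs) (enc_list enc_pair ws))"
begin

abbreviation "enc_nodes \<equiv> enc_list (\<lambda>i. SCons (Sym i) (enc_nats (bs i))) ns"

lemma K_ge_1: "1 \<le> K"
  by (simp add: K)

lemma U_bounds:
  "m \<le> U" "(K + 1) * (K + 1) * m \<le> U" "m * ((K + 1) * m) \<le> U"
  "(K * K + 1) * ((K + 1) * (m * (m * m))) = U" "(K + 1) * (m * (m * m)) \<le> U"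
  using time_unit_bounds[OF K_ge_1, of m] m(6) unfolding U by auto

lemma length_table_le: "i \<in> I \<Longrightarrow> length (table E i) \<le> K"
  using \<beta> by (subst tab.simps, intro order_trans[OF length_reduce_le]) (simp add: K power_increasing)

lemma small_table:
  assumes "set (edge_sets E) \<subseteq> F" "distinct (edge_sets E)" "i \<in> I" "e \<in> set (table E i)"
  shows "small m e"
proof -
  have "card (component (set (edge_sets E)) i) \<le> card I"
    using component_nodes[OF assms(1,3)] finite_I by (rule card_mono[rotated])
  then have "card (component (set (edge_sets E)) i) * (\<beta> + 1) < m"
    using m(4) le_less_trans[OF mult_le_mono1] by blast
  then show ?thesis
    using length_tab_entry[OF assms(1-3) \<beta> assms(4)] by (simp add: small_def)
qed

lemma reduce_runs_unit:
  assumes "\<forall>e\<in>set L. small m e" "i \<in> I" "length L \<le> K * K"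
  shows "runs 8 [enc_verts lb vs, enc_list enc_pair ws, enc_nats (bs i), enc_list enc_entry L]
    (enc_list enc_entry (reduce lb vs W (bs i) L)) (700 * U)"
proof (rule runs_mono)
  have "length (bs i) < m" "8 ^ length (bs i) \<le> K"
    using \<beta> m(5) assms(2) by (auto simp: K intro: power_increasing le_less_trans)
  then show "runs 8 [enc_verts lb vs, enc_list enc_pair ws, enc_nats (bs i), enc_list enc_entry L]
    (enc_list enc_entry (reduce lb vs W (bs i) L)) ((length L + 1) * ((K + 1) * (700 * (m * (m * m)))))"
    using reduce_runs[OF assms(1) m(1,2) _ order_refl] ws by blast
  have "(length L + 1) * ((K + 1) * (m * (m * m))) \<le> (K * K + 1) * ((K + 1) * (m * (m * m)))"
    using assms(3) by (intro mult_le_mono) auto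
  then show "(length L + 1) * ((K + 1) * (700 * (m * (m * m)))) \<le> 700 * U"
    using U_bounds(4) by (simp add: algebra_simps)
qed

text \<open>The calls form a full binary tree whose leaves are the nodes of the component, hence
  \<open>2 * c - 1\<close> calls for \<open>c\<close> nodes. The most expensive kind is a leaf, with
  \<open>600 * U\<close> for the candidates and \<open>700 * U\<close> for reducing;
  \<open>2000 * U\<close> is ample.\<close>

lemma tab_runs:
  assumes "set (edge_sets E) \<subseteq> F" "distinct (edge_sets E)" "i \<in> I" "length E < m"
  shows "runs 16 [x, enc_nodes, enc_list enc_pair E, Sym i] (enc_list enc_entry (table E i))
    ((2 * card (component (set (edge_sets E)) i) - 1) * (2000 * U))"
  using assms
proof (induction "length E" arbitrary: E i rule: less_induct)
  case less
  have bag: "runs 15 [enc_nodes, Sym i] (enc_nats (bs i)) (40 * U)"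
    using bag_runs[of i ns bs] ns less.prems(3) m(3) U_bounds(1) by (auto intro: runs_mono)
  have pick: "runs 13 [enc_list enc_pair E, Sym i] (case pick E i of None \<Rightarrow> SNil | Some k \<Rightarrow> Sym k) (40 * U)"
    using pick_runs[of E i] less.prems(4) U_bounds(1) by (auto intro: runs_mono)
  have del: "runs 14 [enc_list enc_pair E, Sym i] (enc_list enc_pair (del E i)) (40 * U)"
    using del_runs[of E i] less.prems(4) U_bounds(1) by (auto intro: runs_mono)
  have U2: "2 \<le> U" using U_bounds(1) m(6) by simp
  show ?case
  proof (cases "pick E i")
    case None
    then have comp: "component (set (edge_sets E)) i = {i}" using pick_None by (intro component_isolated) blast
    have T: "table E i = reduce lb vs W (bs i) (cands r (bs i))"
      by (subst tab.simps) (simp add: None)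
    have le: "length (bs i) + 1 \<le> m" using \<beta> m(5) less.prems(3) by fastforce
    have "(2::nat) ^ length (bs i) \<le> 2 ^ \<beta>" using \<beta> less.prems(3) by (simp add: power_increasing)
    also have "\<dots> \<le> K" unfolding K by (rule power_mono) auto
    finally have two: "2 ^ length (bs i) \<le> K" .
    have cands: "runs 12 [Sym r, enc_nats (bs i)] (enc_list enc_entry (cands r (bs i))) (600 * U)"
    proof (rule runs_mono[OF cands_runs[OF m(6)]])
      have "(length (bs i) + 1) * ((2 ^ length (bs i) + 1) * m) \<le> m * ((K + 1) * m)"
        using two le by (intro mult_le_mono) auto
      then show "(length (bs i) + 1) * ((2 ^ length (bs i) + 1) * (600 * m)) \<le> 600 * U"
        using U_bounds(3) by (simp add: algebra_simps)
    qed
    have "1 * (\<beta> + 1) \<le> card I * (\<beta> + 1)"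
      using less.prems(3) finite_I by (intro mult_le_mono1) (auto simp: Suc_le_eq card_gt_0_iff)
    then have "length (bs i) + 1 < m" using \<beta> less.prems(3) m(4) by fastforce
    then have "small m e" if "e \<in> set (cands r (bs i))" for e
      using length_cands_entry[OF that] by (simp add: small_def)
    moreover have "length (cands r (bs i)) \<le> K * K"
      using two order_trans[OF _ le_square] by (simp add: length_cands)
    ultimately have red: "runs 8 [enc_verts lb vs, enc_list enc_pair ws, enc_nats (bs i),
        enc_list enc_entry (cands r (bs i))] (enc_list enc_entry (table E i)) (700 * U)"
      unfolding T using less.prems(3) by (intro reduce_runs_unit) auto
    show ?thesis
      using U2 comp
      by (auto simp: runs_unfold tab_body_def Let_def x
          intro!: runs_call[OF bag] runs_call[OF pick[unfolded None option.case]] runs_call[OF cands] runs_call[OF red])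
  next
    case (Some k)
    note p = pick_Some[OF Some less.prems(2)]
    let ?E = "set (edge_sets (del E i))"
    have eq: "?E = set (edge_sets E) - {{i, k}}" using p by blast
    have e: "{i, k} \<in> set (edge_sets E)" using p by blast
    have k: "k \<in> I" using e less.prems(1) edge_nodes by blast
    have sub: "?E \<subseteq> F" using eq less.prems(1) by blast
    have d: "distinct (edge_sets (del E i))" using p by blast
    have len: "length (del E i) < m" using length_del[OF Some] less.prems(4) by simp
    have T: "table E i = reduce lb vs W (bs i) (joins (table (del E i) i) (table (del E i) k))"
      by (subst tab.simps) (simp add: Some)
    have sm: "\<forall>e\<in>set (table (del E i) j). small m e" if "j \<in> I" for j
      using small_table[OF sub d that] by blast
    have le: "length (table (del E i) j) \<le> K" if "j \<in> I" for j
      using length_table_le[OF that] .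
    have prod: "runs 11 [enc_list enc_entry (table (del E i) i), enc_list enc_entry (table (del E i) k)]
      (enc_list enc_entry (joins (table (del E i) i) (table (del E i) k))) (170 * U)"
    proof (rule runs_mono[OF product_runs])
      have "(length (table (del E i) i) + 1) * ((length (table (del E i) k) + 1) * m) \<le> (K + 1) * ((K + 1) * m)"
        using le less.prems(3) k by (intro mult_le_mono) auto
      then show "(length (table (del E i) i) + 1) * ((length (table (del E i) k) + 1) * (170 * m)) \<le> 170 * U"
        using U_bounds(2) by (simp add: algebra_simps)
    qed (use sm less.prems(3) m(6) in auto)
    have "small m e" if e': "e \<in> set (joins (table (del E i) i) (table (del E i) k))" for e
    proof -
      obtain e1 e2 where e12: "e1 \<in> set (table (del E i) i)" "e2 \<in> set (table (del E i) k)" "e = join e1 e2"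
        using e' by (auto simp: set_joins)
      have "card (component ?E i) + card (component ?E k) \<le> card I"
        using card_component_split[OF e less.prems(1)] eq component_nodes[OF less.prems(1) less.prems(3)]
          card_mono[OF finite_I] by metis
      then have "(card (component ?E i) + card (component ?E k)) * (\<beta> + 1) < m"
        using m(4) le_less_trans[OF mult_le_mono1] by blast
      then show ?thesis
        using length_tab_entry[OF sub d less.prems(3) \<beta> e12(1)] length_tab_entry[OF sub d k \<beta> e12(2)]
        by (simp add: e12(3) small_def join_def algebra_simps)
    qed
    moreover have "length (joins (table (del E i) i) (table (del E i) k)) \<le> K * K"
      unfolding length_joins using le less.prems(3) k by (intro mult_le_mono) auto
    ultimately have red: "runs 8 [enc_verts lb vs, enc_list enc_pair ws, enc_nats (bs i),
        enc_list enc_entry (joins (table (del E i) i) (table (del E i) k))] (enc_list enc_entry (table E i)) (700 * U)"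
      unfolding T using less.prems(3) by (intro reduce_runs_unit) auto
    have IH: "runs 16 [x, enc_nodes, enc_list enc_pair (del E i), Sym j] (enc_list enc_entry (table (del E i) j))
      ((2 * card (component ?E j) - 1) * (2000 * U))" if "j \<in> I" for j
      using less.hyps[OF length_del[OF Some] sub d that len] .
    have fin: "finite (component ?E j)" if "j \<in> I" for j
      using component_nodes[OF sub that] finite_I by (rule finite_subset)
    have pos: "0 < card (component ?E j)" if "j \<in> I" for j
      by (metis card_gt_0_iff component_refl empty_iff fin that)
    \<comment> \<open>Successors remove the truncated subtraction from the bound.\<close>
    obtain c1 c2 where c: "card (component ?E i) = Suc c1" "card (component ?E k) = Suc c2"
      using pos[OF less.prems(3)] pos[OF k] by (metis gr0_implies_Suc)
    have cc: "card (component (set (edge_sets E)) i) = Suc (Suc (c1 + c2))"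
      using card_component_split[OF e less.prems(1)] c eq by simp
    show ?thesis
      unfolding cc using U2
      by (auto simp: runs_unfold tab_body_def Let_def x algebra_simps
          intro!: runs_call[OF bag] runs_call[OF pick[unfolded Some option.case]] runs_call[OF del]
            runs_call[OF IH[OF less.prems(3), unfolded x c]] runs_call[OF IH[OF k, unfolded x c]]
            runs_call[OF prod] runs_call[OF red])
  qed
qed

text \<open>The table of the whole tree takes one unit of \<open>2000 * U\<close> less than the
  bound; that unit pays for the final reduction and for listing the literals.\<close>

lemma main_runs:
  assumes E: "set (edge_sets E) = F" "distinct (edge_sets E)" "length E < m" and ns': "ns = i # ns'"
    and R: "reduce lb vs W [] (table E i) = [(S, Z)]"
  shows "runs 0 [x, SCons enc_nodes (enc_list enc_pair E)] (enc_nats (lits lb vs (set S)))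
    (2 * card I * (2000 * U))"
proof -
  have i: "i \<in> I" using ns ns' by auto
  have sm: "\<forall>e\<in>set (table E i). small m e" using small_table E i by blast
  have tab: "runs 16 [x, enc_nodes, enc_list enc_pair E, Sym i] (enc_list enc_entry (table E i))
    ((2 * card I - 1) * (2000 * U))"
    using tab_runs[of E i] E i component_all[OF i] by simp
  have red: "runs 8 [enc_verts lb vs, enc_list enc_pair ws, SNil, enc_list enc_entry (table E i)]
    (SCons (enc_entry (S, Z)) SNil) (1400 * U)"
  proof (rule runs_mono)
    show "runs 8 [enc_verts lb vs, enc_list enc_pair ws, SNil, enc_list enc_entry (table E i)]
      (SCons (enc_entry (S, Z)) SNil) ((length (table E i) + 1) * ((1 + 1) * (700 * (m * (m * m)))))"
      \<comment> \<open>The table size for the empty bag is \<open>8 ^ 0 = 1\<close>.\<close>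
      using reduce_runs[OF sm m(1,2), of "[]" "m * (m * m)" 1 lb] m(6) R ws by simp
    have "(length (table E i) + 1) * (m * (m * m)) \<le> (K + 1) * (m * (m * m))"
      using length_table_le[OF i] by (intro mult_le_mono1) simp
    then have "(length (table E i) + 1) * (m * (m * m)) \<le> U" using U_bounds(5) by (rule order_trans)
    then show "(length (table E i) + 1) * ((1 + 1) * (700 * (m * (m * m)))) \<le> 1400 * U"
      by (simp add: algebra_simps)
  qed
  have "(S, Z) \<in> set (table E i)" using set_reduce[of lb vs W "[]" "table E i"] R by auto
  then have S: "length S < m" using sm by (auto simp: small_def)
  have lits: "runs 4 [enc_verts lb vs, enc_nats S] (enc_nats (lits lb vs (set S))) (50 * U)"
  proof (rule runs_mono[OF lits_runs[OF S order_refl]])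
    have "(length vs + 1) * (m * m) \<le> m * (m * m)" using m(1) by (intro mult_le_mono1) simp
    also have "\<dots> \<le> (K + 1) * (m * (m * m))" by simp
    finally show "(length vs + 1) * (50 * (m * m)) \<le> 50 * U"
      using U_bounds(5) by (simp add: algebra_simps)
  qed
  have U2: "2 \<le> U" using U_bounds(1) m(6) by simp
  obtain c where c: "card I = Suc c" using i finite_I by (metis card_gt_0_iff empty_iff gr0_implies_Suc)
  have hd: "car (car enc_nodes) = Sym i" by (simp add: ns')
  show ?thesis
    unfolding c using U2
    by (auto simp: runs_unfold main_body_def Let_def x hd algebra_simps
        intro!: runs_call[OF tab[unfolded c x]] runs_call[OF red] runs_call[OF lits])
qed

end

end

section \<open>Satisfying assignments as sets of vertices\<close>

lemma wf_wires: "circuit C \<Longrightarrow> wf (wires C)"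
  by (auto simp: circuit_def intro!: finite_acyclic_wf intro: finite_subset)

lemma valid_imp_true_at:
  assumes C: "circuit C" and S: "S \<union> Z = verts C" "valid (lab C) (verts C) (wires C) {} S Z"
    and \<sigma>: "\<And>v x b. v \<in> S \<Longrightarrow> lab C v = Lit x b \<Longrightarrow> \<sigma> x = b"
  shows "v \<in> S \<Longrightarrow> true_at C \<sigma> v"
proof (induction v rule: wf_induct_rule[OF wf_wires[OF C]])
  case (1 v)
  have v: "v \<in> verts C" using 1 S(1) by blast
  show ?case
  proof (cases "lab C v")
    case And
    then have "\<not> fed (wires C) v Z" using S(2) v 1(2) by (simp add: valid_def)
    moreover have "u \<in> verts C" if "(u, v) \<in> wires C" for u using C that by (auto simp: circuit_def)
    \<comment> \<open>An input that is not rejected is chosen, because \<open>S\<close> and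
      \<open>Z\<close> cover all vertices.\<close>
    ultimately have "u \<in> S" if "(u, v) \<in> wires C" for u using S(1) that by (auto simp: fed_def)
    then show ?thesis by (intro true_at.conj[OF And] 1(1))
  next
    case Or
    then have "fed (wires C) v S" using S(2) v 1(2) by (simp add: valid_def)
    then obtain u where u: "u \<in> S" "(u, v) \<in> wires C" by (auto simp: fed_def)
    show ?thesis by (rule true_at.disj[OF Or u(2) 1(1)[OF u(2,1)]])
  next
    case (Lit x b)
    then show ?thesis using \<sigma>[OF 1(2) Lit] by (rule true_at.lit)
  qed
qed

lemma true_at_imp_valid:
  fixes \<tau> :: "nat \<Rightarrow> bool"
  assumes C: "circuit C"
  defines "X \<equiv> {v \<in> verts C. true_at C \<tau> v}"
  shows "valid (lab C) (verts C) (wires C) {} X (verts C - X)"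
  unfolding valid_def
proof (intro ballI impI conjI)
  fix v assume v: "v \<in> verts C" "v \<in> X"
  then have t: "true_at C \<tau> v" by (simp add: X_def)
  show "\<not> fed (wires C) v (verts C - X)" if "lab C v = And"
    using t that by cases (auto simp: fed_def X_def)
  show "v \<in> {} \<or> fed (wires C) v X" if "lab C v = Or"
    using t that C by cases (auto simp: fed_def X_def circuit_def)
qed

text \<open>The solution that \<open>best_entry\<close> asks for: every gate has an input, so
  choosing everything feeds every OR-gate.\<close>

lemma all_valid:
  assumes "circuit C"
  shows "valid (lab C) (verts C) (wires C) {} (verts C) (verts C - verts C)"
  unfolding valid_def
proof (intro ballI impI conjI)
  fix v assume v: "v \<in> verts C"
  show "\<not> fed (wires C) v (verts C - verts C)" by (simp add: fed_def)
  show "v \<in> {} \<or> fed (wires C) v (verts C)" if "lab C v = Or"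
    using assms v that by (fastforce simp: circuit_def fed_def)
qed

text \<open>Input vertices have distinct labels, and positive literals with distinct labels have
  distinct variables. Hence counting vertices is counting variables.\<close>

lemma var_of_inj:
  assumes C: "circuit C" and mon: "monotone_circuit C"
  shows "inj_on (\<lambda>v. var_of (lab C v)) (input_verts C)"
proof
  fix u v assume u: "u \<in> input_verts C" and v: "v \<in> input_verts C" and eq: "var_of (lab C u) = var_of (lab C v)"
  obtain x y where "lab C u = Lit x True" "lab C v = Lit y True"
    using mon u v unfolding monotone_circuit_def by blast
  then have "lab C u = lab C v" using eq by simp
  then show "u = v" using C u v by (auto simp: circuit_def dest: inj_onD)
qed

text \<open>Setting just the variables of the chosen literals makes all chosen vertices true.
  Conversely, the vertices true under a satisfying \<open>\<tau>\<close> form a competitor whose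
  literals inject into the variables that \<open>\<tau>\<close> sets.\<close>

lemma assignment_of_valid:
  assumes C: "circuit C" and mon: "monotone_circuit C" and vs: "distinct vs" "set vs = verts C"
    and S: "S \<union> Z = verts C" "valid (lab C) (verts C) (wires C) {} S Z" "out C \<in> S"
    and opt: "\<forall>Y. out C \<in> Y \<and> Y \<subseteq> verts C \<and> valid (lab C) (verts C) (wires C) {} Y (verts C - Y) \<longrightarrow>
      lit_count (lab C) (verts C) S \<le> lit_count (lab C) (verts C) Y"
  shows "\<exists>\<sigma>. encodes_assignment C (enc_nats (lits (lab C) vs S)) \<sigma> \<and> min_weight_satisfying C \<sigma>"
proof -
  let ?xs = "lits (lab C) vs S"
  define \<sigma> where "\<sigma> = (\<lambda>x. x \<in> set ?xs)"
  have in_S: "{v \<in> set vs. is_lit (lab C v) \<and> v \<in> S} \<subseteq> input_verts C"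
    using vs by (auto simp: input_verts_def)
  have "distinct ?xs"
    unfolding lits_def using vs inj_on_subset[OF var_of_inj[OF C mon] in_S] by (simp add: distinct_map)
  moreover have vars: "set ?xs \<subseteq> vars C"
    using vs by (auto simp: lits_def vars_def is_lit_def) (metis var_of.simps(1))
  then have set: "set ?xs = {x \<in> vars C. \<sigma> x}" by (auto simp: \<sigma>_def)
  ultimately have enc: "encodes_assignment C (enc_nats ?xs) \<sigma>"
    unfolding encodes_assignment_def by blast
  have weight: "weight C \<sigma> = lit_count (lab C) (verts C) S"
    unfolding weight_def set[symmetric] using \<open>distinct ?xs\<close> length_lits[OF vs(1)] vs(2)
    by (simp add: distinct_card)
  have "\<sigma> x = b" if v: "v \<in> S" "lab C v = Lit x b" for v x b
  proof -
    have v': "v \<in> verts C" using v S(1) by blast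
    then have "v \<in> input_verts C" using v by (simp add: input_verts_def is_lit_def)
    then obtain y where "lab C v = Lit y True" using mon unfolding monotone_circuit_def by blast
    then have "b" using v by simp
    moreover have "x \<in> set ?xs"
      using v v' vs by (force simp: lits_def is_lit_def)
    ultimately show ?thesis by (simp add: \<sigma>_def)
  qed
  then have "satisfies \<sigma> C"
    unfolding satisfies_def using valid_imp_true_at[OF C S(1,2), of \<sigma>] S(3) by blast
  moreover have "weight C \<sigma> \<le> weight C \<tau>" if "satisfies \<tau> C" for \<tau>
  proof -
    define X where "X = {v \<in> verts C. true_at C \<tau> v}"
    have "out C \<in> X"
      using that C by (auto simp: X_def satisfies_def circuit_def gate_verts_def)
    then have "weight C \<sigma> \<le> lit_count (lab C) (verts C) X"
      unfolding weight using opt true_at_imp_valid[OF C, of \<tau>] by (auto simp: X_def)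
    also have "\<dots> \<le> weight C \<tau>"
      unfolding lit_count_def weight_def
    proof (rule card_inj_on_le)
      show "inj_on (\<lambda>v. var_of (lab C v)) {v \<in> verts C. is_lit (lab C v) \<and> v \<in> X}"
        using var_of_inj[OF C mon] by (rule inj_on_subset) (auto simp: input_verts_def)
      show "(\<lambda>v. var_of (lab C v)) ` {v \<in> verts C. is_lit (lab C v) \<and> v \<in> X} \<subseteq> {x \<in> vars C. \<tau> x}"
      proof clarsimp
        fix v assume v: "v \<in> verts C" "is_lit (lab C v)" "v \<in> X"
        then obtain x where x: "lab C v = Lit x True"
          using mon by (auto simp: monotone_circuit_def input_verts_def)
        have "true_at C \<tau> v" using v by (simp add: X_def)
        then have "\<tau> x" using x by cases auto
        then show "var_of (lab C v) \<in> vars C \<and> \<tau> (var_of (lab C v))"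
          using x v(1) by (auto simp: vars_def)
      qed
      have "vars C = (\<lambda>v. var_of (lab C v)) ` input_verts C"
        by (force simp: vars_def input_verts_def is_lit_def)
      then show "finite {x \<in> vars C. \<tau> x}"
        using C by (simp add: circuit_def input_verts_def)
    qed
    finally show ?thesis .
  qed
  ultimately show ?thesis using enc by (auto simp: min_weight_satisfying_def)
qed

lemma decomposed_circuit_of_tree_decomposition:
  assumes C: "circuit C" "lab C (out C) = And"
    and T: "tree_decomposition (graph_without_output C) T"
    and bs: "\<forall>i\<in>nodes T. distinct (bs i) \<and> set (bs i) = bag T i"
    and vs: "distinct vs" "set vs = verts C"
  shows "decomposed_circuit (lab C) (verts C) (wires C) (out C) (tedges T) (nodes T) bs vs"
proof -
  have tree: "simple_graph (nodes T, tedges T)" "connected_in (tedges T) (nodes T)" "\<nexists>p. cycle (tedges T) p"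
    and cover: "(\<Union>i\<in>nodes T. bag T i) = verts C - {out C}"
    and edges: "\<forall>e\<in>snd (graph_without_output C). \<exists>i\<in>nodes T. e \<subseteq> bag T i"
    and conn: "\<forall>v\<in>verts C - {out C}. connected_in (tedges T) {i \<in> nodes T. v \<in> bag T i}"
    using T by (simp_all add: tree_decomposition_def tree_def graph_without_output_def)
  have bag: "set (bs i) = bag T i" if "i \<in> nodes T" for i using bs that by blast
  have edge: "i \<in> nodes T \<and> k \<in> nodes T \<and> i \<noteq> k" if "{i, k} \<in> tedges T" for i k
    using tree(1) that by (fastforce simp: simple_graph_def doubleton_eq_iff)
  have wires: "u \<noteq> out C" if "(u, v) \<in> wires C" for u v
    using C that by (auto simp: circuit_def)
  show ?thesis
  proof unfold_locales
    show "finite (verts C)" "lab C (out C) = And" "(out C, v) \<notin> wires C" for v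
      using C by (auto simp: circuit_def)
    show "finite (nodes T)" using tree(1) by (simp add: simple_graph_def)
    show "i \<in> nodes T \<and> k \<in> nodes T \<and> i \<noteq> k" if "{i, k} \<in> tedges T" for i k
      using edge[OF that] .
    show "(i, j) \<in> (adj (tedges T))\<^sup>*" if "i \<in> nodes T" "j \<in> nodes T" for i j
    proof -
      have "{(a, b). a \<in> nodes T \<and> b \<in> nodes T \<and> {a, b} \<in> tedges T} \<subseteq> adj (tedges T)"
        by (auto simp: adj_def)
      then show ?thesis using tree(2) that rtrancl_mono unfolding connected_in_def by blast
    qed
    show "\<nexists>p. cycle (tedges T) p" by (rule tree(3))
    show "(a, b) \<in> {(a, b). v \<in> set (bs a) \<and> v \<in> set (bs b) \<and> {a, b} \<in> tedges T}\<^sup>*"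
      if ab: "a \<in> nodes T" "b \<in> nodes T" "v \<in> set (bs a)" "v \<in> set (bs b)" for a b v
    proof -
      let ?S = "{i \<in> nodes T. v \<in> bag T i}"
      have "connected_in (tedges T) ?S" using conn cover bag ab by blast
      then have "(a, b) \<in> {(a, b). a \<in> ?S \<and> b \<in> ?S \<and> {a, b} \<in> tedges T}\<^sup>*"
        using ab bag unfolding connected_in_def by blast
      moreover have "{(a, b). a \<in> ?S \<and> b \<in> ?S \<and> {a, b} \<in> tedges T} \<subseteq>
        {(a, b). v \<in> set (bs a) \<and> v \<in> set (bs b) \<and> {a, b} \<in> tedges T}"
        using bag by auto
      ultimately show ?thesis using rtrancl_mono by blast
    qed
    show "distinct vs" "set vs = verts C" by (fact vs)+
    show "distinct (bs i)" if "i \<in> nodes T" for i using bs that by blast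
    show "out C \<notin> set (bs i)" if "i \<in> nodes T" for i using bag cover that by blast
    show "\<exists>j\<in>nodes T. u \<in> set (bs j) \<and> v \<in> set (bs j)" if w: "(u, v) \<in> wires C" "v \<noteq> out C" for u v
    proof -
      have "{u, v} \<in> snd (graph_without_output C)"
        using w wires[OF w(1)] unfolding graph_without_output_def by auto
      then obtain j where "j \<in> nodes T" "{u, v} \<subseteq> bag T j" using edges by blast
      then show ?thesis using bag by auto
    qed
    have "out C \<in> verts C" using C by (auto simp: circuit_def gate_verts_def)
    moreover have "(\<Union>i\<in>nodes T. set (bs i)) = verts C - {out C}" using cover bag by simp
    ultimately show "verts C = insert (out C) (\<Union>i\<in>nodes T. set (bs i))" by auto
  qed
qed

text \<open>\<open>h\<close> bounds the numbers of circuit vertices and of tree nodes and the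
  lengths of the entries. Wires and tree edges are pairs, so \<open>h * h\<close> bounds all lists,
  and \<open>m\<close> exceeds it by one because the running times assume strict
  inequalities.\<close>

lemma program_correct:
  assumes C: "circuit C" "lab C (out C) = And" "monotone_circuit C"
    and T: "tree_decomposition (graph_without_output C) T"
    and x: "encodes_circuit x C" and y: "encodes_tree_dec y T"
  defines "h \<equiv> card (nodes T) * (width T + 2)" and "K \<equiv> 8 ^ (width T + 1)"
  shows "\<exists>z n \<sigma>. computes prog [x, y] z n \<and> encodes_assignment C z \<sigma> \<and> min_weight_satisfying C \<sigma> \<and>
    n \<le> 4000 * card (nodes T) * ((K * K + 1) * (K + 1) * ((h * h + 1) * ((h * h + 1) * (h * h + 1))))"
proof -
  obtain vs ws where vs: "distinct vs" "set vs = verts C" and ws: "distinct ws" "set ws = wires C"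
    and x: "x = SCons (Sym (out C)) (SCons (enc_verts (lab C) vs) (enc_list enc_pair ws))"
    using x unfolding encodes_circuit_def by blast
  obtain ns E bs where ns: "distinct ns" "set ns = nodes T"
    and E: "distinct (edge_sets E)" "(\<lambda>(i, j). {i, j}) ` set E = tedges T"
    and bs: "\<forall>i\<in>nodes T. distinct (bs i) \<and> set (bs i) = bag T i"
    and y: "y = SCons (enc_list (\<lambda>i. SCons (Sym i) (enc_nats (bs i))) ns) (enc_list enc_pair E)"
    using y unfolding encodes_tree_dec_def by blast
  interpret decomposed_circuit "lab C" "verts C" "wires C" "out C" "tedges T" "nodes T" bs vs
    by (rule decomposed_circuit_of_tree_decomposition[OF C(1,2) T bs vs])
  have E': "set (edge_sets E) = tedges T" using E(2) by simp
  have "nodes T \<noteq> {}" using T by (simp add: tree_decomposition_def tree_def)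
  then obtain i ns' where i: "ns = i # ns'" using ns by (cases ns) auto
  have iT: "i \<in> nodes T" using i ns(2) by auto
  have N: "1 \<le> card (nodes T)" using \<open>nodes T \<noteq> {}\<close> finite_I by (simp add: Suc_le_eq card_gt_0_iff)
  have bag: "card (bag T j) \<le> width T + 1" if "j \<in> nodes T" for j
  proof -
    have "card (bag T j) \<le> Max ((\<lambda>i. card (bag T i)) ` nodes T)"
      using that finite_I by (intro Max_ge) auto
    \<comment> \<open>Holds even where the subtraction in \<open>width\<close> truncates.\<close>
    then show ?thesis unfolding width_def by linarith
  qed
  have \<beta>: "\<forall>j\<in>nodes T. length (bs j) \<le> width T + 1"
    using bag bs by (metis distinct_card)
  have h: "2 \<le> h" "card (nodes T) \<le> h" "width T + 2 \<le> h"
    using N mult_le_mono1[OF N, of "width T + 2"] by (auto simp: h_def)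
  have V: "card (verts C) \<le> h"
  proof -
    have "card (verts C) \<le> card (\<Union>j\<in>nodes T. set (bs j)) + 1"
      by (subst cover) (use card_insert_le_m1 finite_I in \<open>auto simp: card_insert_if\<close>)
    also have "card (\<Union>j\<in>nodes T. set (bs j)) \<le> (\<Sum>j\<in>nodes T. card (set (bs j)))"
      using finite_I by (rule card_UN_le)
    also have "\<dots> \<le> card (nodes T) * (width T + 1)"
      using sum_bounded_above[of "nodes T" "\<lambda>j. card (set (bs j))" "width T + 1"] bag bs by simp
    \<comment> \<open>The additional vertex is the output; it fits since there is at least one
      node.\<close>
    finally show ?thesis using N by (simp add: h_def)
  qed
  have hh: "h \<le> h * h" by simp
  have ws_len: "length ws \<le> h * h"
  proof -
    have "length ws = card (wires C)" using distinct_card[OF ws(1)] ws(2) by simp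
    also have "\<dots> \<le> card (verts C \<times> verts C)"
      using C(1) by (intro card_mono) (auto simp: circuit_def)
    also have "\<dots> \<le> h * h" using V by (simp add: card_cartesian_product mult_le_mono)
    finally show ?thesis .
  qed
  have E_len: "length E \<le> h * h"
  proof -
    have "length E = card (set E)" using E(1) by (simp add: distinct_map distinct_card)
    also have "\<dots> \<le> card (nodes T \<times> nodes T)"
    proof (rule card_mono)
      show "finite (nodes T \<times> nodes T)" using finite_I by simp
      show "set E \<subseteq> nodes T \<times> nodes T"
      proof (rule subrelI)
        fix a b assume "(a, b) \<in> set E"
        then have "{a, b} \<in> tedges T" using E(2) by force
        then show "(a, b) \<in> nodes T \<times> nodes T" using edge_nodes[of a b] by simp
      qed
    qed
    also have "\<dots> \<le> h * h" using h(2) by (simp add: card_cartesian_product mult_le_mono)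
    finally show ?thesis .
  qed
  define m where "m = h * h + 1"
  define U where "U = (K * K + 1) * (K + 1) * (m * (m * m))"
  have vs_len: "length vs \<le> h * h"
    using order_trans[OF V hh] distinct_card[OF vs(1)] vs(2) by simp
  have ns_len: "length ns \<le> h * h"
    using order_trans[OF h(2) hh] distinct_card[OF ns(1)] ns(2) by simp
  have hN: "card (nodes T) * (width T + 1 + 1) = h" by (simp add: h_def)
  have m: "length vs < m" "length ws < m" "length ns < m" "card (nodes T) * (width T + 1 + 1) < m"
    "width T + 1 < m" "2 \<le> m" "length E < m"
    using vs_len ws_len ns_len E_len order_trans[OF h(1) hh] order_trans[OF h(3) hh] hh hN
    unfolding m_def by linarith+
  have all: "out C \<in> verts C" "verts C \<subseteq> verts C" using cover by auto
  obtain S Z where R: "reduce (lab C) vs (wires C) [] (table E i) = [(S, Z)]"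
    and S: "out C \<in> set S" "set S \<union> set Z = verts C" "valid (lab C) (verts C) (wires C) {} (set S) (set Z)"
    and opt: "\<forall>Y. out C \<in> Y \<and> Y \<subseteq> verts C \<and> valid (lab C) (verts C) (wires C) {} Y (verts C - Y) \<longrightarrow>
      lit_count (lab C) (verts C) (set S) \<le> lit_count (lab C) (verts C) Y"
    by (rule best_entry[OF E' E(1) iT all all_valid[OF C(1)]])
  obtain \<sigma> where \<sigma>: "encodes_assignment C (enc_nats (lits (lab C) vs (set S))) \<sigma>" "min_weight_satisfying C \<sigma>"
    using assignment_of_valid[OF C(1,3) vs S(2,3,1) opt] by blast
  have "runs 0 [x, y] (enc_nats (lits (lab C) vs (set S))) (2 * card (nodes T) * (2000 * U))"
    unfolding y
    by (rule main_runs[OF ws(2) ns(2) \<beta> m(1-6) K_def[THEN meta_eq_to_obj_eq] U_def x E' E(1) m(7) i R])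
  then obtain n where n: "eval prog [x, y] (prog ! 0) (enc_nats (lits (lab C) vs (set S))) n"
    "n \<le> 2 * card (nodes T) * (2000 * U)"
    by (auto simp: runs_def wp_call_def wp_def)
  have "computes prog [x, y] (enc_nats (lits (lab C) vs (set S))) n"
    using n(1) unfolding computes_def by (simp add: prog_def)
  moreover have "n \<le> 4000 * card (nodes T) * U" using n(2) by (simp add: mult.assoc mult.left_commute)
  ultimately show ?thesis using \<sigma> unfolding U_def m_def by blast
qed

text \<open>\<open>K\<close> is \<open>2 ^ (3 * (w + 1))\<close> and enters cubed, and
  \<open>h\<close> is at most \<open>N * 2 ^ (w + 1)\<close> and enters to the sixth power: together
  \<open>2 ^ (15 * (w + 1)) * N ^ 6\<close>, with one more factor \<open>N\<close> for the calls.
  The constants multiply to 128000, which is below \<open>2 ^ 17\<close>, and 15 + 17 = 32.\<close>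

lemma time_bound:
  fixes N w :: nat
  defines "h \<equiv> N * (w + 2)" and "K \<equiv> 8 ^ (w + 1)"
  assumes N: "1 \<le> N"
  shows "4000 * N * ((K * K + 1) * (K + 1) * ((h * h + 1) * ((h * h + 1) * (h * h + 1)))) \<le>
    2 ^ (15 * w + 32) * N ^ 7"
proof -
  have K: "K = 2 ^ (3 * (w + 1))" unfolding K_def power_mult by simp
  have "1 \<le> K" by (simp add: K_def)
  then have "(K * K + 1) * (K + 1) \<le> (2 * (K * K)) * (2 * K)"
    by (intro mult_le_mono) (auto simp: Suc_le_eq)
  also have "\<dots> = 4 * 2 ^ (9 * (w + 1))"
    unfolding K by (simp add: power_add[symmetric] flip: mult_2_right)
  finally have 1: "(K * K + 1) * (K + 1) \<le> 4 * 2 ^ (9 * (w + 1))" .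
  have "w + 2 \<le> 2 ^ (w + 1)" using less_exp[of "w + 1"] by simp
  then have h: "h \<le> N * 2 ^ (w + 1)" unfolding h_def by (rule mult_le_mono2)
  have "1 \<le> h" using N by (simp add: h_def)
  then have "1 \<le> h * h" by simp
  moreover have "h * h \<le> (N * 2 ^ (w + 1)) ^ 2"
    unfolding power2_eq_square by (rule mult_le_mono[OF h h])
  ultimately have "h * h + 1 \<le> 2 * (N * 2 ^ (w + 1)) ^ 2" by linarith
  then have "(h * h + 1) ^ 3 \<le> (2 * (N * 2 ^ (w + 1)) ^ 2) ^ 3"
    by (rule power_mono) simp
  also have "\<dots> = 8 * N ^ 6 * 2 ^ (6 * (w + 1))"
    by (simp add: power_mult_distrib flip: power_mult) (simp add: algebra_simps power_add)
  finally have 2: "(h * h + 1) * ((h * h + 1) * (h * h + 1)) \<le> 8 * N ^ 6 * 2 ^ (6 * (w + 1))"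
    by (simp only: power3_eq_cube mult.assoc)
  have regroup: "4000 * N * (4 * a * (8 * N ^ 6 * b)) = 128000 * (a * b) * N ^ 7" for a b :: nat
  proof -
    have "N ^ 7 = N * N ^ 6" by (simp flip: power_Suc)
    then show ?thesis by simp
  qed
  have "4000 * N * ((K * K + 1) * (K + 1) * ((h * h + 1) * ((h * h + 1) * (h * h + 1)))) \<le>
    4000 * N * (4 * 2 ^ (9 * (w + 1)) * (8 * N ^ 6 * 2 ^ (6 * (w + 1))))"
    using mult_le_mono[OF 1 2] by (rule mult_le_mono2)
  also have "\<dots> = 128000 * (2 ^ (9 * (w + 1)) * 2 ^ (6 * (w + 1))) * N ^ 7"
    by (rule regroup)
  also have "2 ^ (9 * (w + 1)) * 2 ^ (6 * (w + 1)) = (2 :: nat) ^ (15 * (w + 1))"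
    by (simp flip: power_add)
  also have "128000 * 2 ^ (15 * (w + 1)) * N ^ 7 \<le> 2 ^ 17 * 2 ^ (15 * (w + 1)) * N ^ 7"
    by (intro mult_le_mono1) simp
  also have "(2 :: nat) ^ 17 * 2 ^ (15 * (w + 1)) = 2 ^ (15 * w + 32)"
    unfolding power_add[symmetric] by (rule arg_cong[of _ _ "power 2"]) simp
  finally show ?thesis .
qed

theorem theorem9:
  "\<exists>(P :: program) (f :: nat \<Rightarrow> real) (g :: nat \<Rightarrow> real).
     f \<in> O(\<lambda>\<omega>. real \<omega>) \<and> g \<in> O(\<lambda>N. 1) \<and>
     (\<forall>t C T \<omega> N x y.
        2 \<le> t \<and> pi_circuit t C \<and> monotone_circuit C \<and>
        tree_decomposition (graph_without_output C) T \<and> width T = \<omega> \<and> card (nodes T) = N \<and>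
        encodes_circuit x C \<and> encodes_tree_dec y T \<longrightarrow>
        (\<exists>z n \<sigma>. computes P [x, y] z n \<and> encodes_assignment C z \<sigma> \<and>
           min_weight_satisfying C \<sigma> \<and> real n \<le> 2 powr f \<omega> * real N powr g N))"
proof (rule exI[of _ prog], rule exI[of _ "\<lambda>\<omega>. real (15 * \<omega> + 32)"], rule exI[of _ "\<lambda>N. 7"],
    intro conjI allI impI)
  show "(\<lambda>\<omega>. real (15 * \<omega> + 32)) \<in> O(\<lambda>\<omega>. real \<omega>)"
    \<comment> \<open>The constant is 15 + 32, valid from \<omega> = 1 on.\<close>
    by (intro bigoI[of _ 47] eventually_sequentiallyI[of 1]) simp
  show "(\<lambda>N. 7 :: real) \<in> O(\<lambda>N. 1)"
    by simp
  fix t C T \<omega> N x y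
  assume asm: "2 \<le> t \<and> pi_circuit t C \<and> monotone_circuit C \<and>
        tree_decomposition (graph_without_output C) T \<and> width T = \<omega> \<and> card (nodes T) = N \<and>
        encodes_circuit x C \<and> encodes_tree_dec y T"
  have C: "circuit C" "lab C (out C) = And" "monotone_circuit C"
    and T: "tree_decomposition (graph_without_output C) T"
    and xy: "encodes_circuit x C" "encodes_tree_dec y T"
    using asm by (auto simp: pi_circuit_def)
  have "nodes T \<noteq> {}" "finite (nodes T)"
    using T by (auto simp: tree_decomposition_def tree_def simple_graph_def)
  then have N: "1 \<le> N" using asm by (auto simp: Suc_le_eq card_gt_0_iff)
  obtain z n \<sigma> where z: "computes prog [x, y] z n" "encodes_assignment C z \<sigma>" "min_weight_satisfying C \<sigma>"
    and n: "n \<le> 2 ^ (15 * \<omega> + 32) * N ^ 7"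
    using program_correct[OF C T xy] time_bound[OF N, of \<omega>] asm by (meson order_trans)
  have "real n \<le> real (2 ^ (15 * \<omega> + 32) * N ^ 7)"
    using n by (rule of_nat_mono)
  also have "\<dots> = 2 powr real (15 * \<omega> + 32) * real N powr 7"
    using N powr_realpow[of 2 "15 * \<omega> + 32"] powr_realpow[of "real N" 7] by simp
  finally show "\<exists>z n \<sigma>. computes prog [x, y] z n \<and> encodes_assignment C z \<sigma> \<and>
           min_weight_satisfying C \<sigma> \<and> real n \<le> 2 powr real (15 * \<omega> + 32) * real N powr 7"
    using z by blast
qed

end
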